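(* Let $(M,\omega)$ be a pre-$n$-plectic manifold, $H\in\Omega^{n-1}_{\mathrm{Ham}}(M)$, and let $(f)=\{f_i\}_{1\le i\le n}$ be a co-momentum map for a multisymplectic infinitesimal action $\mathfrak g\to\mathfrak X(M,\omega)$, $x\mapsto v_x$, which is locally $H$-preserving, i.e. $\mathcal L_{v_x}H$ is closed for all $x\in\mathfrak g$. If $p\in B_k(\mathfrak g)\subset Z_k(\mathfrak g)$, $1\le k\le n$, then $f_k(p)$ is globally conserved by any Hamiltonian vector field $v_H$ of $H$, i.e. $\mathcal L_{v_H}f_k(p)$ is an exact form.
   Context: A pre-$n$-plectic manifold ($n\ge 1$) is a smooth manifold $M$ with a closed form $\omega\in\Omega^{n+1}(M)$. A form $\alpha\in\Omega^{n-1}(M)$ is Hamiltonian if there is a vector field $v_\alpha$ (a Hamiltonian vector field for $\alpha$; not necessarily unique) with $d\alpha=-\iota_{v_\alpha}\omega$; $\Omega^{n-1}_{\mathrm{Ham}}(M)$ is the set of Hamiltonian $(n-1)$-forms. Contraction with multivector fields: $\iota(v_1\wedge\dots\wedge v_k)=\iota_{v_k}\cdots\iota_{v_1}$. $\mathfrak g$ is a real Lie algebra; a multisymplectic infinitesimal action is a Lie algebra homomorphism $x\mapsto v_x$ from $\mathfrak g$ to $\mathfrak X(M,\omega)=\{X\in\mathfrak X(M):\mathcal L_X\omega=0\}$. For $p=x_1\wedge\dots\wedge x_k$ put $v_p=v_{x_1}\wedge\dots\wedge v_{x_k}$, extended linearly to $p\in\Lambda^k\mathfrak g$. Lie algebra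 homology differential: $\partial_k:\Lambda^k\mathfrak g\to\Lambda^{k-1}\mathfrak g$, $\partial(x_1\wedge\dots\wedge x_k)=\sum_{1\le i<j\le k}(-1)^{i+j}[x_i,x_j]\wedge x_1\wedge\dots\wedge\hat x_i\wedge\dots\wedge\hat x_j\wedge\dots\wedge x_k$; $Z_k(\mathfrak g)=\ker\partial_k$ and $B_k(\mathfrak g)=\mathrm{im}\,\partial_{k+1}\subset\Lambda^k\mathfrak g$. Let $\varsigma(k)=-(-1)^{k(k+1)/2}$. A (homotopy) co-momentum map is a collection of linear maps $f_i:\Lambda^i\mathfrak g\to\Omega^{n-i}(M)$, $1\le i\le n$, with $f_1(\mathfrak g)\subset\Omega^{n-1}_{\mathrm{Ham}}(M)$, $d(f_1(x))=-\iota_{v_x}\omega$ for all $x\in\mathfrak g$, and, setting $f_0=f_{n+1}=0$, $-f_{k-1}(\partial p)=df_k(p)+\varsigma(k)\iota(v_p)\omega$ for all $1\le k\le n+1$, $p\in\Lambda^k\mathfrak g$. *)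

theory Defs
  imports "HOL-Analysis.Analysis" "HOL-Analysis.Finite_Function_Topology"
    "HOL-Library.Function_Algebras"
begin

section \<open>Smooth manifolds\<close>

text \<open>
  \<open>Euclidean_space d\<close> is the library's \<open>\<real>\<^sup>d\<close> for a natural number \<open>d\<close> (possibly 0):
  sequences that vanish from index \<open>d\<close> on.  For a function on an open subset \<open>V\<close> of it,
  \<open>Ck_on d V k f\<close> says that all iterated partial derivatives up to order \<open>k\<close> exist and are
  continuous on \<open>V\<close>.
\<close>

definition partial_deriv :: "nat \<Rightarrow> ((nat \<Rightarrow> real) \<Rightarrow> real) \<Rightarrow> (nat \<Rightarrow> real) \<Rightarrow> real" where
  "partial_deriv i f x = deriv (\<lambda>t. f (x(i := t))) (x i)"

primrec Ck_on :: "nat \<Rightarrow> (nat \<Rightarrow> real) set \<Rightarrow> nat \<Rightarrow> ((nat \<Rightarrow> real) \<Rightarrow> real) \<Rightarrow> bool" where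
  "Ck_on d V 0 f \<longleftrightarrow>
     continuous_map (subtopology (Euclidean_space d) V) euclideanreal f"
| "Ck_on d V (Suc k) f \<longleftrightarrow>
     continuous_map (subtopology (Euclidean_space d) V) euclideanreal f \<and>
     (\<forall>i<d. (\<forall>x\<in>V. (\<lambda>t. f (x(i := t))) field_differentiable at (x i)) \<and>
            Ck_on d V k (partial_deriv i f))"

definition smooth_on :: "nat \<Rightarrow> (nat \<Rightarrow> real) set \<Rightarrow> ((nat \<Rightarrow> real) \<Rightarrow> real) \<Rightarrow> bool" where
  "smooth_on d V f \<longleftrightarrow> (\<forall>k. Ck_on d V k f)"

text \<open>A chart is a domain together with its coordinate map.\<close>

type_synonym 'm atlas = "('m set \<times> ('m \<Rightarrow> nat \<Rightarrow> real)) set"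

text \<open>
  The manifold is the whole type \<open>'m\<close>, Hausdorff and second countable by its type classes, with
  smooth structure determined by a (not necessarily maximal) atlas.
\<close>

definition smooth_manifold ::
    "nat \<Rightarrow> ('m::{t2_space, second_countable_topology}) atlas \<Rightarrow> bool" where
  "smooth_manifold d A \<longleftrightarrow>
     (\<Union>(U, \<phi>)\<in>A. U) = UNIV \<and>
     (\<forall>(U, \<phi>)\<in>A. open U \<and> openin (Euclidean_space d) (\<phi> ` U) \<and>
        homeomorphic_map (top_of_set U) (subtopology (Euclidean_space d) (\<phi> ` U)) \<phi>) \<and>
     (\<forall>(U, \<phi>)\<in>A. \<forall>(W, \<psi>)\<in>A. \<forall>j<d.
        smooth_on d (\<phi> ` (U \<inter> W)) (\<lambda>x. \<psi> (inv_into U \<phi> x) j))"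

definition smooth_functions :: "nat \<Rightarrow> 'm atlas \<Rightarrow> ('m \<Rightarrow> real) set" where
  "smooth_functions d A =
     {f. \<forall>(U, \<phi>)\<in>A. smooth_on d (\<phi> ` U) (\<lambda>x. f (inv_into U \<phi> x))}"


section \<open>Vector fields and differential forms\<close>

text \<open>
  Vector fields are the derivations of the algebra \<open>C\<^sup>\<infinity>(M)\<close>, and differential \<open>k\<close>-forms are the
  alternating \<open>C\<^sup>\<infinity>(M)\<close>-multilinear maps \<open>\<XX>(M)\<^sup>k \<rightarrow> C\<^sup>\<infinity>(M)\<close> (Helgason, \<open>Differential Geometry, Lie
  Groups, and Symmetric Spaces\<close>, Ch. I, 2).  Outside their domain the functions that represent
  them are normalised to 0, so that equality of vector fields or forms is equality in HOL.
  Sums, negatives and products of functions are pointwise.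
\<close>

type_synonym 'm vfield = "('m \<Rightarrow> real) \<Rightarrow> ('m \<Rightarrow> real)"
type_synonym 'm form = "'m vfield list \<Rightarrow> ('m \<Rightarrow> real)"

definition vector_fields :: "nat \<Rightarrow> 'm atlas \<Rightarrow> 'm vfield set" where
  "vector_fields d A =
     {X. (\<forall>f\<in>smooth_functions d A. X f \<in> smooth_functions d A) \<and>
         (\<forall>f. f \<notin> smooth_functions d A \<longrightarrow> X f = 0) \<and>
         (\<forall>f\<in>smooth_functions d A. \<forall>g\<in>smooth_functions d A. X (f + g) = X f + X g) \<and>
         (\<forall>f\<in>smooth_functions d A. \<forall>c. X (\<lambda>m. c * f m) = (\<lambda>m. c * X f m)) \<and>
         (\<forall>f\<in>smooth_functions d A. \<forall>g\<in>smooth_functions d A. X (f * g) = f * X g + X f * g)}"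

definition vf_bracket :: "'m vfield \<Rightarrow> 'm vfield \<Rightarrow> 'm vfield" where
  "vf_bracket X Y = (\<lambda>f. X (Y f) - Y (X f))"

definition forms :: "nat \<Rightarrow> 'm atlas \<Rightarrow> nat \<Rightarrow> 'm form set" where
  "forms d A k =
     {\<alpha>. (\<forall>Xs. length Xs = k \<and> set Xs \<subseteq> vector_fields d A \<longrightarrow> \<alpha> Xs \<in> smooth_functions d A) \<and>
         (\<forall>Xs. \<not> (length Xs = k \<and> set Xs \<subseteq> vector_fields d A) \<longrightarrow> \<alpha> Xs = 0) \<and>
         (\<forall>Xs i X Y. length Xs = k \<and> set Xs \<subseteq> vector_fields d A \<and> i < k \<and>
            X \<in> vector_fields d A \<and> Y \<in> vector_fields d A \<longrightarrow>
            \<alpha> (Xs[i := X + Y]) = \<alpha> (Xs[i := X]) + \<alpha> (Xs[i := Y])) \<and>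
         (\<forall>Xs i X g. length Xs = k \<and> set Xs \<subseteq> vector_fields d A \<and> i < k \<and>
            X \<in> vector_fields d A \<and> g \<in> smooth_functions d A \<longrightarrow>
            \<alpha> (Xs[i := (\<lambda>f. g * X f)]) = g * \<alpha> (Xs[i := X])) \<and>
         (\<forall>Xs i j. length Xs = k \<and> set Xs \<subseteq> vector_fields d A \<and> i < j \<and> j < k \<and>
            Xs ! i = Xs ! j \<longrightarrow> \<alpha> Xs = 0)}"

text \<open>
  The exterior derivative in its invariant form.  As the arguments are numbered from 0, the signs
  of the first sum are \<open>(-1)\<^sup>i\<close>; \<open>nths Xs (- {i, j})\<close> omits the entries \<open>i\<close> and \<open>j\<close>.
\<close>

definition ext_deriv :: "nat \<Rightarrow> 'm atlas \<Rightarrow> 'm form \<Rightarrow> 'm form" where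
  "ext_deriv d A \<alpha> = (\<lambda>Xs. if set Xs \<subseteq> vector_fields d A then
       (\<lambda>m. (\<Sum>i<length Xs. (-1) ^ i * (Xs ! i) (\<alpha> (nths Xs (- {i}))) m)
          + (\<Sum>j<length Xs. \<Sum>i<j. (-1) ^ (i + j) *
               \<alpha> (vf_bracket (Xs ! i) (Xs ! j) # nths Xs (- {i, j})) m))
     else 0)"

definition lie_deriv :: "nat \<Rightarrow> 'm atlas \<Rightarrow> 'm vfield \<Rightarrow> 'm form \<Rightarrow> 'm form" where
  "lie_deriv d A X \<alpha> = (\<lambda>Xs. if set Xs \<subseteq> vector_fields d A then
       X (\<alpha> Xs) - (\<Sum>i<length Xs. \<alpha> (Xs[i := vf_bracket X (Xs ! i)]))
     else 0)"

definition interior_product :: "'m vfield \<Rightarrow> 'm form \<Rightarrow> 'm form" where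
  "interior_product X \<alpha> = (\<lambda>Xs. \<alpha> (X # Xs))"

text \<open>\<open>contract [v\<^sub>1, \<dots>, v\<^sub>k] \<alpha>\<close> is \<open>\<iota>(v\<^sub>1 \<and> \<dots> \<and> v\<^sub>k) \<alpha> = \<iota>\<^bsub>v\<^sub>k\<^esub> \<cdots> \<iota>\<^bsub>v\<^sub>1\<^esub> \<alpha>\<close>.\<close>

definition contract :: "'m vfield list \<Rightarrow> 'm form \<Rightarrow> 'm form" where
  "contract vs \<alpha> = fold interior_product vs \<alpha>"

definition closed_form :: "nat \<Rightarrow> 'm atlas \<Rightarrow> 'm form \<Rightarrow> bool" where
  "closed_form d A \<alpha> \<longleftrightarrow> ext_deriv d A \<alpha> = 0"

text \<open>Exactness of a \<open>k\<close>-form; as there are no forms of degree \<open>-1\<close>, an exact 0-form is zero.\<close>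

definition exact_form :: "nat \<Rightarrow> 'm atlas \<Rightarrow> nat \<Rightarrow> 'm form \<Rightarrow> bool" where
  "exact_form d A k \<alpha> \<longleftrightarrow>
     (case k of 0 \<Rightarrow> \<alpha> = 0 | Suc j \<Rightarrow> \<exists>\<beta>\<in>forms d A j. \<alpha> = ext_deriv d A \<beta>)"


section \<open>The exterior algebra of a real vector space\<close>

text \<open>
  The quotient of the free vector space on all finite lists of vectors by the relations of
  multilinearity and alternation.  These are homogeneous in the length of the lists, so that the
  quotient is the direct sum of the exterior powers.
\<close>

definition ext_relators :: "('g::real_vector list, real) poly_mapping set" where
  "ext_relators =
     {Poly_Mapping.single (xs @ (x + y) # ys) 1 - Poly_Mapping.single (xs @ x # ys) 1
        - Poly_Mapping.single (xs @ y # ys) 1 | xs x y ys. True} \<union>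
     {Poly_Mapping.single (xs @ (c *\<^sub>R x) # ys) 1 - c *\<^sub>R Poly_Mapping.single (xs @ x # ys) 1
        | xs c x ys. True} \<union>
     {Poly_Mapping.single xs 1 | xs. \<not> distinct xs}"

definition ext_equiv ::
    "('g::real_vector list, real) poly_mapping \<Rightarrow> ('g list, real) poly_mapping \<Rightarrow> bool" where
  "ext_equiv p q \<longleftrightarrow> p - q \<in> span ext_relators"

quotient_type (overloaded) 'g ext_algebra = "('g::real_vector list, real) poly_mapping" / ext_equiv
  morphisms rep_ext abs_ext
proof (rule equivpI)
  show "reflp ext_equiv"
    by (simp add: reflp_def ext_equiv_def span_zero)
  show "symp ext_equiv"
    unfolding ext_equiv_def by (rule sympI) (use span_neg in fastforce)
  show "transp ext_equiv"
    unfolding ext_equiv_def by (rule transpI) (use span_add in fastforce)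
qed

instantiation ext_algebra :: (real_vector) real_vector
begin

lift_definition zero_ext_algebra :: "'a ext_algebra" is 0 .

lift_definition plus_ext_algebra :: "'a ext_algebra \<Rightarrow> 'a ext_algebra \<Rightarrow> 'a ext_algebra" is "(+)"
  unfolding ext_equiv_def by (simp add: add_diff_add span_add)

lift_definition minus_ext_algebra :: "'a ext_algebra \<Rightarrow> 'a ext_algebra \<Rightarrow> 'a ext_algebra" is "(-)"
proof -
  fix p q r s :: "('a list, real) poly_mapping"
  assume "ext_equiv p q" "ext_equiv r s"
  then have "(p - q) - (r - s) \<in> span ext_relators"
    unfolding ext_equiv_def by (rule span_diff)
  then show "ext_equiv (p - r) (q - s)"
    by (simp add: ext_equiv_def algebra_simps)
qed

lift_definition uminus_ext_algebra :: "'a ext_algebra \<Rightarrow> 'a ext_algebra" is uminus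
  unfolding ext_equiv_def using span_neg by fastforce

lift_definition scaleR_ext_algebra :: "real \<Rightarrow> 'a ext_algebra \<Rightarrow> 'a ext_algebra" is scaleR
  unfolding ext_equiv_def by (simp add: span_scale flip: scaleR_right_diff_distrib)

instance
  by standard
    (transfer; simp add: ext_equiv_def span_zero algebra_simps scaleR_left_distrib
        scaleR_right_distrib)+

end

text \<open>\<open>wedge [x\<^sub>1, \<dots>, x\<^sub>k]\<close> is \<open>x\<^sub>1 \<and> \<dots> \<and> x\<^sub>k\<close>; in particular \<open>wedge [x]\<close> is \<open>x\<close> itself.\<close>

definition wedge :: "'g::real_vector list \<Rightarrow> 'g ext_algebra" where
  "wedge xs = abs_ext (Poly_Mapping.single xs 1)"

definition ext_power :: "nat \<Rightarrow> 'g::real_vector ext_algebra set" where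
  "ext_power k = span (wedge ` {xs. length xs = k})"

text \<open>
  \<open>ext_lift F\<close> is the linear extension of \<open>wedge xs \<mapsto> F xs\<close>, meaningful for multilinear alternating
  \<open>F\<close>: see \<open>linear_ext_lift\<close> and \<open>ext_lift_wedge\<close>.
\<close>

definition free_lift :: "('g list \<Rightarrow> 'b::real_vector) \<Rightarrow> ('g list, real) poly_mapping \<Rightarrow> 'b" where
  "free_lift F q = (\<Sum>xs\<in>Poly_Mapping.keys q. Poly_Mapping.lookup q xs *\<^sub>R F xs)"

definition ext_lift :: "('g::real_vector list \<Rightarrow> 'b::real_vector) \<Rightarrow> 'g ext_algebra \<Rightarrow> 'b" where
  "ext_lift F p = free_lift F (rep_ext p)"

definition multilinear_alternating :: "('g::real_vector list \<Rightarrow> 'b::real_vector) \<Rightarrow> bool" where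
  "multilinear_alternating F \<longleftrightarrow>
     (\<forall>xs ys. linear (\<lambda>x. F (xs @ x # ys))) \<and> (\<forall>xs. \<not> distinct xs \<longrightarrow> F xs = 0)"

lemma free_lift_superset:
  assumes "finite S" "Poly_Mapping.keys q \<subseteq> S"
  shows "free_lift F q = (\<Sum>xs\<in>S. Poly_Mapping.lookup q xs *\<^sub>R F xs)"
  unfolding free_lift_def
  by (rule sum.mono_neutral_left) (use assms in \<open>auto simp: in_keys_iff\<close>)

lemma lookup_scaleR_free:
  "Poly_Mapping.lookup (c *\<^sub>R (q :: ('a, real) poly_mapping)) x = c * Poly_Mapping.lookup q x"
proof -
  have "finite {i. c * Poly_Mapping.lookup q i \<noteq> 0}"
    by (rule finite_subset[OF _ finite_lookup[of q]]) auto
  then show ?thesis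
    by (simp add: scaleR_poly_mapping_def Abs_poly_mapping_inverse)
qed

lemma linear_free_lift: "linear (free_lift F)"
proof (rule linearI)
  fix p q :: "('a list, real) poly_mapping" and c :: real
  let ?S = "Poly_Mapping.keys p \<union> Poly_Mapping.keys q"
  have "Poly_Mapping.keys (p + q) \<subseteq> ?S" by (rule Poly_Mapping.keys_add)
  then show "free_lift F (p + q) = free_lift F p + free_lift F q"
    by (simp add: free_lift_superset[of ?S] lookup_add scaleR_left_distrib sum.distrib)
  have "Poly_Mapping.keys (c *\<^sub>R q) \<subseteq> Poly_Mapping.keys q"
    by (auto simp: in_keys_iff lookup_scaleR_free)
  then show "free_lift F (c *\<^sub>R q) = c *\<^sub>R free_lift F q"
    by (simp add: free_lift_superset[of "Poly_Mapping.keys q"] lookup_scaleR_free scaleR_sum_right)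
qed

lemma free_lift_single: "free_lift F (Poly_Mapping.single xs 1) = F xs"
  by (simp add: free_lift_def)

lemma ext_lift_abs_ext:
  assumes "multilinear_alternating F"
  shows "ext_lift F (abs_ext q) = free_lift F q"
proof -
  have "free_lift F r = 0" if "r \<in> ext_relators" for r
  proof -
    have add: "F (xs @ (x + y) # ys) = F (xs @ x # ys) + F (xs @ y # ys)"
      and scale: "F (xs @ (c *\<^sub>R x) # ys) = c *\<^sub>R F (xs @ x # ys)" for xs ys x y c
    proof -
      have "linear (\<lambda>x. F (xs @ x # ys))"
        using assms by (simp add: multilinear_alternating_def)
      from linear_add[OF this] linear_scale[OF this]
      show "F (xs @ (x + y) # ys) = F (xs @ x # ys) + F (xs @ y # ys)"
        "F (xs @ (c *\<^sub>R x) # ys) = c *\<^sub>R F (xs @ x # ys)" .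
    qed
    show ?thesis
      using that assms
      by (auto simp: ext_relators_def multilinear_alternating_def free_lift_single add scale
          linear_diff[OF linear_free_lift] linear_scale[OF linear_free_lift])
  qed
  moreover have "rep_ext (abs_ext q) - q \<in> span ext_relators"
    by (metis Quotient3_abs_rep Quotient3_ext_algebra ext_algebra.abs_eq_iff ext_equiv_def)
  ultimately have "free_lift F (rep_ext (abs_ext q) - q) = 0"
    by (metis linear_eq_0_on_span linear_free_lift)
  then show ?thesis
    by (simp add: ext_lift_def linear_diff[OF linear_free_lift])
qed

lemma ext_lift_wedge: "multilinear_alternating F \<Longrightarrow> ext_lift F (wedge xs) = F xs"
  by (simp add: wedge_def ext_lift_abs_ext free_lift_single)

lemma linear_ext_lift:
  assumes "multilinear_alternating F"
  shows "linear (ext_lift F)"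
proof (rule linearI)
  fix p q :: "'a ext_algebra" and c :: real
  obtain p' q' where eq: "p = abs_ext p'" "q = abs_ext q'"
    by (metis Quotient3_abs_rep Quotient3_ext_algebra)
  show "ext_lift F (p + q) = ext_lift F p + ext_lift F q"
    by (simp add: eq plus_ext_algebra.abs_eq ext_lift_abs_ext[OF assms] linear_add[OF linear_free_lift])
  show "ext_lift F (c *\<^sub>R q) = c *\<^sub>R ext_lift F q"
    by (simp add: eq scaleR_ext_algebra.abs_eq ext_lift_abs_ext[OF assms] linear_scale[OF linear_free_lift])
qed


section \<open>Lie algebras and their homology differential\<close>

definition lie_algebra :: "('g::real_vector \<Rightarrow> 'g \<Rightarrow> 'g) \<Rightarrow> bool" where
  "lie_algebra br \<longleftrightarrow>
     bilinear br \<and> (\<forall>x. br x x = 0) \<and>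
     (\<forall>x y z. br x (br y z) + br y (br z x) + br z (br x y) = 0)"

text \<open>Numbering the factors from 0 instead of 1 does not change the signs \<open>(-1)\<^sup>i\<^sup>+\<^sup>j\<close>.\<close>

definition lie_boundary :: "('g::real_vector \<Rightarrow> 'g \<Rightarrow> 'g) \<Rightarrow> 'g ext_algebra \<Rightarrow> 'g ext_algebra" where
  "lie_boundary br = ext_lift (\<lambda>xs. \<Sum>j<length xs. \<Sum>i<j.
     (-1) ^ (i + j) *\<^sub>R wedge (br (xs ! i) (xs ! j) # nths xs (- {i, j})))"

definition lie_cycles :: "('g::real_vector \<Rightarrow> 'g \<Rightarrow> 'g) \<Rightarrow> nat \<Rightarrow> 'g ext_algebra set" where
  "lie_cycles br k = {p \<in> ext_power k. lie_boundary br p = 0}"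

definition lie_boundaries :: "('g::real_vector \<Rightarrow> 'g \<Rightarrow> 'g) \<Rightarrow> nat \<Rightarrow> 'g ext_algebra set" where
  "lie_boundaries br k = lie_boundary br ` ext_power (Suc k)"


section \<open>Multisymplectic geometry\<close>

definition pre_plectic ::
    "nat \<Rightarrow> ('m::{t2_space, second_countable_topology}) atlas \<Rightarrow> nat \<Rightarrow> 'm form \<Rightarrow> bool" where
  "pre_plectic d A n \<omega> \<longleftrightarrow>
     1 \<le> n \<and> smooth_manifold d A \<and> \<omega> \<in> forms d A (n + 1) \<and> closed_form d A \<omega>"

definition hamiltonian_vf :: "nat \<Rightarrow> 'm atlas \<Rightarrow> 'm form \<Rightarrow> 'm form \<Rightarrow> 'm vfield \<Rightarrow> bool" where
  "hamiltonian_vf d A \<omega> \<alpha> X \<longleftrightarrow>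
     X \<in> vector_fields d A \<and> ext_deriv d A \<alpha> = - interior_product X \<omega>"

definition hamiltonian_forms :: "nat \<Rightarrow> 'm atlas \<Rightarrow> nat \<Rightarrow> 'm form \<Rightarrow> 'm form set" where
  "hamiltonian_forms d A n \<omega> = {\<alpha> \<in> forms d A (n - 1). \<exists>X. hamiltonian_vf d A \<omega> \<alpha> X}"

definition multisymplectic_action ::
    "nat \<Rightarrow> 'm atlas \<Rightarrow> 'm form \<Rightarrow> ('g::real_vector \<Rightarrow> 'g \<Rightarrow> 'g) \<Rightarrow> ('g \<Rightarrow> 'm vfield) \<Rightarrow> bool" where
  "multisymplectic_action d A \<omega> br v \<longleftrightarrow>
     (\<forall>x. v x \<in> vector_fields d A \<and> lie_deriv d A (v x) \<omega> = 0) \<and>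
     (\<forall>x y. v (x + y) = v x + v y) \<and>
     (\<forall>c x. v (c *\<^sub>R x) = (\<lambda>f m. c * v x f m)) \<and>
     (\<forall>x y. v (br x y) = vf_bracket (v x) (v y))"

text \<open>\<open>contract_ext v p \<alpha>\<close> is \<open>\<iota>(v\<^sub>p) \<alpha>\<close> for \<open>p\<close> in the exterior algebra.\<close>

definition contract_ext ::
    "('g::real_vector \<Rightarrow> 'm vfield) \<Rightarrow> 'g ext_algebra \<Rightarrow> 'm form \<Rightarrow> 'm form" where
  "contract_ext v p \<alpha> = (\<lambda>Xs m. ext_lift (\<lambda>xs. contract (map v xs) \<alpha> Xs m) p)"

definition varsigma :: "nat \<Rightarrow> real" where
  "varsigma k = - ((-1) ^ (k * (k + 1) div 2))"

text \<open>\<open>f\<^sub>0 = f\<^bsub>n+1\<^esub> = 0\<close>\<close>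

definition zero_extend ::
    "nat \<Rightarrow> (nat \<Rightarrow> 'g ext_algebra \<Rightarrow> 'm form) \<Rightarrow> nat \<Rightarrow> 'g::real_vector ext_algebra \<Rightarrow> 'm form" where
  "zero_extend n f i = (if 1 \<le> i \<and> i \<le> n then f i else 0)"

definition co_momentum_map ::
    "nat \<Rightarrow> 'm atlas \<Rightarrow> nat \<Rightarrow> 'm form \<Rightarrow> ('g::real_vector \<Rightarrow> 'g \<Rightarrow> 'g) \<Rightarrow> ('g \<Rightarrow> 'm vfield) \<Rightarrow>
       (nat \<Rightarrow> 'g ext_algebra \<Rightarrow> 'm form) \<Rightarrow> bool" where
  "co_momentum_map d A n \<omega> br v f \<longleftrightarrow>
     (\<forall>i\<in>{1..n}. \<forall>p\<in>ext_power i. f i p \<in> forms d A (n - i)) \<and>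
     (\<forall>i\<in>{1..n}. \<forall>p\<in>ext_power i. \<forall>q\<in>ext_power i. f i (p + q) = f i p + f i q) \<and>
     (\<forall>i\<in>{1..n}. \<forall>p\<in>ext_power i. \<forall>c. f i (c *\<^sub>R p) = (\<lambda>Xs m. c * f i p Xs m)) \<and>
     (\<forall>x. f 1 (wedge [x]) \<in> hamiltonian_forms d A n \<omega>) \<and>
     (\<forall>x. ext_deriv d A (f 1 (wedge [x])) = - interior_product (v x) \<omega>) \<and>
     (\<forall>k\<in>{1..n + 1}. \<forall>p\<in>ext_power k.
        - zero_extend n f (k - 1) (lie_boundary br p) =
        ext_deriv d A (zero_extend n f k p) +
          (\<lambda>Xs m. varsigma k * contract_ext v p \<omega> Xs m))"

definition locally_preserving ::
    "nat \<Rightarrow> 'm atlas \<Rightarrow> 'm form \<Rightarrow> ('g \<Rightarrow> 'm vfield) \<Rightarrow> bool" where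
  "locally_preserving d A H v \<longleftrightarrow> (\<forall>x. closed_form d A (lie_deriv d A (v x) H))"

definition globally_conserved ::
    "nat \<Rightarrow> 'm atlas \<Rightarrow> nat \<Rightarrow> 'm vfield \<Rightarrow> 'm form \<Rightarrow> bool" where
  "globally_conserved d A k X \<alpha> \<longleftrightarrow> exact_form d A k (lie_deriv d A X \<alpha>)"

end

theory Submission
  imports Defs
begin

text \<open>
  Write \<open>p = \<partial>q\<close> with \<open>q \<in> \<Lambda>\<^sup>k\<^sup>+\<^sup>1 \<gg>\<close>.  The co-momentum equation for \<open>q\<close> reads
  \<open>f\<^sub>k(p) = - d\<beta> - \<sigma>(k + 1) \<iota>(v\<^sub>q) \<omega>\<close>, where \<open>\<sigma>\<close> is the sign \<open>varsigma\<close> and \<open>\<beta>\<close> is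
  \<open>f\<^bsub>k+1\<^esub>(q)\<close>, or 0 if \<open>k = n\<close>.  A Lie derivative commutes with \<open>d\<close>, so the first term
  contributes the exact form \<open>- d \<L> \<beta>\<close> to the derivative \<open>\<L>\<close> of \<open>f\<^sub>k(p)\<close> along \<open>v\<^sub>H\<close>.

  The second term contributes nothing (\<open>lie_d_contract_ext\<close>).  The field \<open>v\<^sub>H\<close> preserves \<open>\<omega>\<close>, because
  \<open>\<L> \<omega> = d \<iota>(v\<^sub>H) \<omega> = - d d H = 0\<close>.  As \<open>\<L>\<close> commutes with \<open>\<iota>(v\<^sub>x)\<close> up to \<open>\<iota>[v\<^sub>H, v\<^sub>x]\<close>, it
  suffices that \<open>\<iota>[v\<^sub>H, v\<^sub>x] \<omega> = 0\<close>.  Since \<open>v\<^sub>x\<close> preserves \<open>\<omega>\<close>, this is up to sign the Lie derivative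
  along \<open>v\<^sub>x\<close> of \<open>\<iota>(v\<^sub>H) \<omega> = - dH\<close>, that is, \<open>d\<close> of the Lie derivative of \<open>H\<close> along \<open>v\<^sub>x\<close>,
  which vanishes by local preservation.

  The Cartan calculus behind this and the identity \<open>\<partial>\<partial> = 0\<close> (whence boundaries are cycles) are two
  instances of one theory: alternating maps on a Lie ring \<open>L\<close> with values in an \<open>L\<close>-module \<open>N\<close>.
  Vector fields acting on smooth functions give differential forms.  For \<open>\<gg>\<close> acting by zero on
  \<open>\<Lambda>\<gg>\<close>, the wedge product is such a map, and its differential sends \<open>x\<^sub>1, \<dots>, x\<^sub>k\<close> to
  \<open>\<partial>(x\<^sub>1 \<and> \<dots> \<and> x\<^sub>k)\<close>.  That the differential of an alternating map is alternating then says that \<open>\<partial>\<close> is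
  well defined, and \<open>dd = 0\<close> says that \<open>\<partial>\<partial> = 0\<close>.  In the general theory everything follows by
  induction on the list of arguments from two recursions: the commutation of Lie derivatives with
  contractions (\<open>lie_d_Cons\<close>) and Cartan's formula (\<open>ce_d_Cons\<close>).
\<close>

section \<open>Cartan calculus for cochains of a Lie ring\<close>

text \<open>
  The sign \<open>(-1)\<^sup>n\<close> as an operation on an abelian group, so that it makes sense both for functions and
  for elements of an exterior algebra.
\<close>
definition alt_sign :: "nat \<Rightarrow> 'b::ab_group_add \<Rightarrow> 'b" where
  "alt_sign n x = (if even n then x else - x)"

lemma alt_sign_simps [simp]:
  "alt_sign 0 x = x" "alt_sign (Suc n) x = - alt_sign n x" "alt_sign n (- x) = - alt_sign n x"
  "alt_sign n 0 = 0"
  by (auto simp: alt_sign_def)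

lemma alt_sign_add: "alt_sign n (x + y) = alt_sign n x + alt_sign n y"
  by (simp add: alt_sign_def)

lemma alt_sign_diff: "alt_sign n (x - y) = alt_sign n x - alt_sign n y"
  by (simp add: alt_sign_def)

lemma nths_UNIV: "nths xs UNIV = xs"
  by (simp add: nths_all)

lemma nths_omit_one: "nths xs (- {i}) = take i xs @ drop (Suc i) xs"
proof (induction xs arbitrary: i)
  case (Cons x xs)
  \<comment> \<open>the index set for the tail of the list, as it arises from \<open>nths_Cons\<close>\<close>
  have "{j. j \<noteq> i - 1 \<or> i = 0} = (if i = 0 then UNIV else - {i - 1})" by auto
  with Cons show ?case
    by (cases i) (auto simp: nths_Cons Compl_eq nths_UNIV)
qed simp

text \<open>
  Carriers are explicit sets because the vector fields, and the smooth functions on which they act,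
  are proper subsets of their types.  The Jacobi identity says that \<open>br X\<close> is a derivation.
\<close>
locale lie_module =
  fixes L :: "'a::ab_group_add set" and br :: "'a \<Rightarrow> 'a \<Rightarrow> 'a"
    and N :: "'b::ab_group_add set" and act :: "'a \<Rightarrow> 'b \<Rightarrow> 'b"
  assumes L_add: "\<lbrakk>X \<in> L; Y \<in> L\<rbrakk> \<Longrightarrow> X + Y \<in> L"
    and L_br: "\<lbrakk>X \<in> L; Y \<in> L\<rbrakk> \<Longrightarrow> br X Y \<in> L"
    and br_add_left: "\<lbrakk>X \<in> L; Y \<in> L; Z \<in> L\<rbrakk> \<Longrightarrow> br (X + Y) Z = br X Z + br Y Z"
    and br_add_right: "\<lbrakk>X \<in> L; Y \<in> L; Z \<in> L\<rbrakk> \<Longrightarrow> br X (Y + Z) = br X Y + br X Z"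
    and br_self: "X \<in> L \<Longrightarrow> br X X = 0"
    and br_br: "\<lbrakk>X \<in> L; Y \<in> L; Z \<in> L\<rbrakk> \<Longrightarrow> br X (br Y Z) = br (br X Y) Z + br Y (br X Z)"
    and N_0: "0 \<in> N"
    and N_add: "\<lbrakk>m \<in> N; n \<in> N\<rbrakk> \<Longrightarrow> m + n \<in> N"
    and N_minus: "m \<in> N \<Longrightarrow> - m \<in> N"
    and N_act: "\<lbrakk>X \<in> L; m \<in> N\<rbrakk> \<Longrightarrow> act X m \<in> N"
    and act_add: "\<lbrakk>X \<in> L; m \<in> N; n \<in> N\<rbrakk> \<Longrightarrow> act X (m + n) = act X m + act X n"
    and act_add_left: "\<lbrakk>X \<in> L; Y \<in> L; m \<in> N\<rbrakk> \<Longrightarrow> act (X + Y) m = act X m + act Y m"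
    and act_br: "\<lbrakk>X \<in> L; Y \<in> L; m \<in> N\<rbrakk> \<Longrightarrow> act (br X Y) m = act X (act Y m) - act Y (act X m)"
begin

lemma N_diff: "\<lbrakk>m \<in> N; n \<in> N\<rbrakk> \<Longrightarrow> m - n \<in> N"
  using N_add[of m "- n"] N_minus by simp

lemma N_sum: "(\<And>i. i \<in> I \<Longrightarrow> h i \<in> N) \<Longrightarrow> sum h I \<in> N"
  by (induction I rule: infinite_finite_induct) (auto simp: N_0 N_add)

lemma N_alt_sign: "m \<in> N \<Longrightarrow> alt_sign n m \<in> N"
  by (simp add: alt_sign_def N_minus)

lemma act_0: "X \<in> L \<Longrightarrow> act X 0 = 0"
  using act_add[of X 0 0] N_0 by simp

lemma act_minus: "\<lbrakk>X \<in> L; m \<in> N\<rbrakk> \<Longrightarrow> act X (- m) = - act X m"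
  using act_add[of X m "- m"] N_minus act_0 by (simp add: minus_unique)

lemma act_diff: "\<lbrakk>X \<in> L; m \<in> N; n \<in> N\<rbrakk> \<Longrightarrow> act X (m - n) = act X m - act X n"
  using act_add[of X m "- n"] N_minus act_minus by simp

text \<open>
  Lists of all lengths are admitted: a form of degree \<open>k\<close> is zero on lists of any other length, and the
  wedge product is naturally given on all lists at once.  Alternation only speaks of equal
  neighbours, which is the form that is easy to propagate by induction on the prefix \<open>As\<close>; see
  \<open>cochain_not_distinct\<close> for arbitrary repetitions.
\<close>
definition cochain :: "('a list \<Rightarrow> 'b) \<Rightarrow> bool" where
  "cochain \<alpha> \<longleftrightarrow>
     (\<forall>Xs. set Xs \<subseteq> L \<longrightarrow> \<alpha> Xs \<in> N) \<and>
     (\<forall>As X Y Bs. set As \<subseteq> L \<and> X \<in> L \<and> Y \<in> L \<and> set Bs \<subseteq> L \<longrightarrow>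
        \<alpha> (As @ (X + Y) # Bs) = \<alpha> (As @ X # Bs) + \<alpha> (As @ Y # Bs)) \<and>
     (\<forall>As X Bs. set As \<subseteq> L \<and> X \<in> L \<and> set Bs \<subseteq> L \<longrightarrow> \<alpha> (As @ X # X # Bs) = 0)"

lemma cochain_N: "\<lbrakk>cochain \<alpha>; set Xs \<subseteq> L\<rbrakk> \<Longrightarrow> \<alpha> Xs \<in> N"
  by (simp add: cochain_def)

lemma cochain_add:
  "\<lbrakk>cochain \<alpha>; set As \<subseteq> L; X \<in> L; Y \<in> L; set Bs \<subseteq> L\<rbrakk> \<Longrightarrow>
     \<alpha> (As @ (X + Y) # Bs) = \<alpha> (As @ X # Bs) + \<alpha> (As @ Y # Bs)"
  by (simp add: cochain_def)

lemma cochain_add_first: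
  "\<lbrakk>cochain \<alpha>; X \<in> L; Y \<in> L; set Bs \<subseteq> L\<rbrakk> \<Longrightarrow>
     \<alpha> ((X + Y) # Bs) = \<alpha> (X # Bs) + \<alpha> (Y # Bs)"
  using cochain_add[of \<alpha> "[]"] by simp

lemma cochain_repeat:
  "\<lbrakk>cochain \<alpha>; set As \<subseteq> L; X \<in> L; set Bs \<subseteq> L\<rbrakk> \<Longrightarrow> \<alpha> (As @ X # X # Bs) = 0"
  by (simp add: cochain_def)

lemma cochain_insert:
  assumes "cochain \<alpha>" "X \<in> L"
  shows "cochain (\<lambda>Ys. \<alpha> (X # Ys))"
  unfolding cochain_def
  using assms cochain_N[of \<alpha> "X # _"] cochain_add[of \<alpha> "X # _"] cochain_repeat[of \<alpha> "X # _"]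
  by simp

text \<open>
  Polarisation: expand the vanishing value at the repeated argument \<open>X + Y\<close>.
\<close>
lemma cochain_swap:
  assumes "cochain \<alpha>" "set As \<subseteq> L" "X \<in> L" "Y \<in> L" "set Bs \<subseteq> L"
  shows "\<alpha> (As @ X # Y # Bs) = - \<alpha> (As @ Y # X # Bs)"
proof -
  have "0 = \<alpha> (As @ (X + Y) # (X + Y) # Bs)"
    using assms by (simp add: cochain_repeat L_add)
  also have "\<dots> = \<alpha> (As @ X # (X + Y) # Bs) + \<alpha> (As @ Y # (X + Y) # Bs)"
    using assms by (subst cochain_add) (auto simp: L_add)
  also have "\<dots> = \<alpha> (As @ X # Y # Bs) + \<alpha> (As @ Y # X # Bs)"
    using assms cochain_add[of \<alpha> "As @ [_]"] by (simp add: cochain_repeat)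
  finally show ?thesis by (simp add: eq_neg_iff_add_eq_0)
qed

text \<open>
  One transposition for each entry that the argument passes.
\<close>
lemma cochain_move:
  assumes "cochain \<alpha>" "set As \<subseteq> L" "X \<in> L" "set Bs \<subseteq> L"
  shows "\<alpha> (As @ X # Bs) = alt_sign (length As) (\<alpha> (X # As @ Bs))"
  using assms
proof (induction As arbitrary: \<alpha>)
  case (Cons A As)
  have "\<alpha> ((A # As) @ X # Bs) = alt_sign (length As) (\<alpha> (A # X # As @ Bs))"
    using Cons.IH[of "\<lambda>Ys. \<alpha> (A # Ys)"] Cons.prems by (simp add: cochain_insert)
  also have "\<alpha> (A # X # As @ Bs) = - \<alpha> (X # A # As @ Bs)"
    using Cons.prems cochain_swap[of \<alpha> "[]" A X "As @ Bs"] by simp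
  finally show ?case by simp
qed simp

text \<open>
  Move the second of two equal arguments next to the first.
\<close>
lemma cochain_not_distinct:
  assumes "cochain \<alpha>" "set Xs \<subseteq> L" "\<not> distinct Xs"
  shows "\<alpha> Xs = 0"
proof -
  obtain As X Bs Cs where Xs: "Xs = As @ [X] @ Bs @ [X] @ Cs"
    using assms(3) not_distinct_decomp by blast
  have "cochain (\<lambda>Ys. \<alpha> (As @ X # Ys))"
  proof -
    have "cochain \<beta> \<Longrightarrow> set Zs \<subseteq> L \<Longrightarrow> cochain (\<lambda>Ys. \<beta> (Zs @ Ys))" for \<beta> Zs
      by (induction Zs arbitrary: \<beta>) (auto dest: cochain_insert)
    from this[of \<alpha> "As @ [X]"] show ?thesis using assms(1,2) Xs by simp
  qed
  from cochain_move[OF this, of Bs X Cs] have "\<alpha> Xs = alt_sign (length Bs) (\<alpha> (As @ X # X # Bs @ Cs))"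
    using assms(2) by (simp add: Xs)
  also have "\<alpha> (As @ X # X # Bs @ Cs) = 0"
    using assms(1,2) by (intro cochain_repeat) (auto simp: Xs)
  finally show ?thesis by simp
qed

lemma cochain_zero_first:
  assumes "cochain \<alpha>" "X \<in> L" "set Bs \<subseteq> L"
  shows "\<alpha> (0 # Bs) = 0"
proof -
  have "0 \<in> L" using br_self[OF assms(2)] L_br[OF assms(2) assms(2)] by simp
  then show ?thesis using cochain_add_first[OF assms(1), of 0 0 Bs] assms(3) by simp
qed

definition lie_d :: "'a \<Rightarrow> ('a list \<Rightarrow> 'b) \<Rightarrow> 'a list \<Rightarrow> 'b" where
  "lie_d X \<alpha> Xs = act X (\<alpha> Xs) - (\<Sum>i<length Xs. \<alpha> (Xs[i := br X (Xs ! i)]))"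

text \<open>
  The Chevalley--Eilenberg differential, with the same numbering and signs as \<open>ext_deriv\<close>.
\<close>
definition ce_d :: "('a list \<Rightarrow> 'b) \<Rightarrow> 'a list \<Rightarrow> 'b" where
  "ce_d \<alpha> Xs =
     (\<Sum>i<length Xs. alt_sign i (act (Xs ! i) (\<alpha> (nths Xs (- {i}))))) +
     (\<Sum>j<length Xs. \<Sum>i<j. alt_sign (i + j) (\<alpha> (br (Xs ! i) (Xs ! j) # nths Xs (- {i, j}))))"

lemma lie_d_Nil [simp]: "lie_d X \<alpha> [] = act X (\<alpha> [])"
  by (simp add: lie_d_def)

text \<open>
  The relation \<open>\<iota>\<^sub>Y \<L>\<^sub>X = \<L>\<^sub>X \<iota>\<^sub>Y - \<iota>\<^bsub>[X,Y]\<^esub>\<close>.  Read from left to right it computes a Lie derivative by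
  recursion on the list of arguments.
\<close>
lemma lie_d_Cons: "lie_d X \<alpha> (Y # Ys) = lie_d X (\<lambda>Zs. \<alpha> (Y # Zs)) Ys - \<alpha> (br X Y # Ys)"
  by (simp add: lie_d_def sum.lessThan_Suc_shift del: sum.lessThan_Suc)

lemma set_update_bracket:
  assumes "X \<in> L" "set Xs \<subseteq> L" "i < length Xs"
  shows "set (Xs[i := br X (Xs ! i)]) \<subseteq> L"
  using assms by (intro set_update_subsetI L_br) auto

lemma nths_subset: "set Xs \<subseteq> L \<Longrightarrow> set (nths Xs I) \<subseteq> L"
  using set_nths_subset[of Xs I] by blast

lemma lie_d_cong:
  assumes "\<And>Ys. set Ys \<subseteq> L \<Longrightarrow> \<alpha> Ys = \<beta> Ys" "X \<in> L" "set Xs \<subseteq> L"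
  shows "lie_d X \<alpha> Xs = lie_d X \<beta> Xs"
  using assms by (simp add: lie_d_def set_update_bracket)

lemma ce_d_cong:
  assumes "\<And>Ys. set Ys \<subseteq> L \<Longrightarrow> \<alpha> Ys = \<beta> Ys" "set Xs \<subseteq> L"
  shows "ce_d \<alpha> Xs = ce_d \<beta> Xs"
  unfolding ce_d_def
proof (intro arg_cong2[where f = "(+)"] sum.cong refl)
  fix i assume "i \<in> {..<length Xs}"
  then show "alt_sign i (act (Xs ! i) (\<alpha> (nths Xs (- {i})))) = alt_sign i (act (Xs ! i) (\<beta> (nths Xs (- {i}))))"
    using assms by (simp add: nths_subset)
next
  fix i j assume "i \<in> {..<j}" "j \<in> {..<length Xs}"
  then have "Xs ! i \<in> L" "Xs ! j \<in> L" using assms(2) by (auto simp: subset_iff)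
  then show "alt_sign (i + j) (\<alpha> (br (Xs ! i) (Xs ! j) # nths Xs (- {i, j})))
    = alt_sign (i + j) (\<beta> (br (Xs ! i) (Xs ! j) # nths Xs (- {i, j})))"
    using assms by (simp add: nths_subset L_br)
qed

lemma N_lie_d:
  assumes "cochain \<alpha>" "X \<in> L" "set Xs \<subseteq> L"
  shows "lie_d X \<alpha> Xs \<in> N"
  unfolding lie_d_def using assms
  by (intro N_diff N_act N_sum cochain_N set_update_bracket) auto

lemma N_ce_d:
  assumes "cochain \<alpha>" "set Xs \<subseteq> L"
  shows "ce_d \<alpha> Xs \<in> N"
proof -
  have "Xs ! i \<in> L" if "i < length Xs" for i using that assms(2) by auto
  then show ?thesis
    unfolding ce_d_def using assms
    by (intro N_add N_sum N_alt_sign N_act cochain_N) (simp_all add: L_br nths_subset)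
qed

lemma lie_d_add:
  assumes "\<And>Ys. set Ys \<subseteq> L \<Longrightarrow> \<alpha> Ys \<in> N" "\<And>Ys. set Ys \<subseteq> L \<Longrightarrow> \<beta> Ys \<in> N" "X \<in> L" "set Xs \<subseteq> L"
  shows "lie_d X (\<lambda>Ys. \<alpha> Ys + \<beta> Ys) Xs = lie_d X \<alpha> Xs + lie_d X \<beta> Xs"
  using assms by (simp add: lie_d_def act_add sum.distrib)

lemma lie_d_diff:
  assumes "\<And>Ys. set Ys \<subseteq> L \<Longrightarrow> \<alpha> Ys \<in> N" "\<And>Ys. set Ys \<subseteq> L \<Longrightarrow> \<beta> Ys \<in> N" "X \<in> L" "set Xs \<subseteq> L"
  shows "lie_d X (\<lambda>Ys. \<alpha> Ys - \<beta> Ys) Xs = lie_d X \<alpha> Xs - lie_d X \<beta> Xs"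
  using assms by (simp add: lie_d_def act_diff sum_subtractf)

lemma lie_d_0: "X \<in> L \<Longrightarrow> lie_d X (\<lambda>Ys. 0) Xs = 0"
  by (simp add: lie_d_def act_0)

lemma ce_d_add:
  assumes "\<And>Ys. set Ys \<subseteq> L \<Longrightarrow> \<alpha> Ys \<in> N" "\<And>Ys. set Ys \<subseteq> L \<Longrightarrow> \<beta> Ys \<in> N" "set Xs \<subseteq> L"
  shows "ce_d (\<lambda>Ys. \<alpha> Ys + \<beta> Ys) Xs = ce_d \<alpha> Xs + ce_d \<beta> Xs"
proof -
  have "Xs ! i \<in> L" if "i < length Xs" for i using that assms(3) by auto
  then show ?thesis
    using assms by (simp add: ce_d_def act_add alt_sign_add sum.distrib nths_subset)
qed

lemma ce_d_diff:
  assumes "\<And>Ys. set Ys \<subseteq> L \<Longrightarrow> \<alpha> Ys \<in> N" "\<And>Ys. set Ys \<subseteq> L \<Longrightarrow> \<beta> Ys \<in> N" "set Xs \<subseteq> L"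
  shows "ce_d (\<lambda>Ys. \<alpha> Ys - \<beta> Ys) Xs = ce_d \<alpha> Xs - ce_d \<beta> Xs"
proof -
  have "Xs ! i \<in> L" if "i < length Xs" for i using that assms(3) by auto
  then show ?thesis
    using assms by (simp add: ce_d_def act_diff alt_sign_diff sum_subtractf nths_subset)
qed

lemma ce_d_0: "set Xs \<subseteq> L \<Longrightarrow> ce_d (\<lambda>Ys. 0) Xs = 0"
  using ce_d_diff[of "\<lambda>_. 0" "\<lambda>_. 0" Xs] N_0 by simp

text \<open>
  If the two leading arguments are equal to \<open>Y\<close>, the terms with \<open>[X, Y]\<close> in the first and in the
  second place cancel by antisymmetry.
\<close>
lemma cochain_lie_d:
  assumes "cochain \<alpha>" "X \<in> L"
  shows "cochain (lie_d X \<alpha>)"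
  unfolding cochain_def
proof (intro conjI allI impI; (elim conjE)?)
  fix Xs assume "set Xs \<subseteq> L"
  then show "lie_d X \<alpha> Xs \<in> N" using assms by (simp add: N_lie_d)
next
  fix As Y Z Bs assume "set As \<subseteq> L" "Y \<in> L" "Z \<in> L" "set Bs \<subseteq> L"
  then show "lie_d X \<alpha> (As @ (Y + Z) # Bs) = lie_d X \<alpha> (As @ Y # Bs) + lie_d X \<alpha> (As @ Z # Bs)"
    using assms
  proof (induction As arbitrary: \<alpha>)
    case Nil
    have "lie_d X (\<lambda>Zs. \<alpha> ((Y + Z) # Zs)) Bs = lie_d X (\<lambda>Zs. \<alpha> (Y # Zs) + \<alpha> (Z # Zs)) Bs"
      using Nil by (intro lie_d_cong) (auto simp: cochain_add_first)
    also have "\<dots> = lie_d X (\<lambda>Zs. \<alpha> (Y # Zs)) Bs + lie_d X (\<lambda>Zs. \<alpha> (Z # Zs)) Bs"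
      using Nil by (intro lie_d_add) (auto simp: cochain_N)
    finally show ?case
      using Nil by (simp add: lie_d_Cons br_add_right cochain_add_first L_br)
  next
    case (Cons A As)
    then show ?case
      using Cons.IH[of "\<lambda>Zs. \<alpha> (A # Zs)"] cochain_add[of \<alpha> "br X A # As" Y Z Bs]
      by (simp add: lie_d_Cons cochain_insert L_br)
  qed
next
  fix As Y Bs assume "set As \<subseteq> L" "Y \<in> L" "set Bs \<subseteq> L"
  then show "lie_d X \<alpha> (As @ Y # Y # Bs) = 0"
    using assms
  proof (induction As arbitrary: \<alpha>)
    case Nil
    have "lie_d X (\<lambda>Zs. \<alpha> (Y # Y # Zs)) Bs = lie_d X (\<lambda>Zs. 0) Bs"
      using Nil cochain_repeat[of \<alpha> "[]"] by (intro lie_d_cong) auto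
    moreover have "\<alpha> (Y # br X Y # Bs) = - \<alpha> (br X Y # Y # Bs)"
      using Nil cochain_swap[of \<alpha> "[]" Y "br X Y" Bs] by (simp add: L_br)
    ultimately show ?case
      using Nil by (simp add: lie_d_Cons lie_d_0)
  next
    case (Cons A As)
    then show ?case
      using Cons.IH[of "\<lambda>Zs. \<alpha> (A # Zs)"] cochain_repeat[of \<alpha> "br X A # As" Y Bs]
      by (simp add: lie_d_Cons cochain_insert L_br)
  qed
qed

lemma lie_d_add_left:
  assumes "cochain \<alpha>" "X \<in> L" "Y \<in> L" "set Xs \<subseteq> L"
  shows "lie_d (X + Y) \<alpha> Xs = lie_d X \<alpha> Xs + lie_d Y \<alpha> Xs"
  using assms
proof (induction Xs arbitrary: \<alpha>)
  case (Cons Z Zs)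
  then show ?case
    using Cons.IH[of "\<lambda>Zs. \<alpha> (Z # Zs)"]
    by (simp add: lie_d_Cons cochain_insert br_add_left cochain_add_first L_br)
qed (simp add: act_add_left cochain_N)

text \<open>
  Contracting with a further argument \<open>Z\<close>, all mixed terms cancel and the three iterated brackets
  that remain sum to zero by the Jacobi identity.
\<close>
lemma lie_d_bracket:
  assumes "cochain \<alpha>" "X \<in> L" "Y \<in> L" "set Xs \<subseteq> L"
  shows "lie_d (br X Y) \<alpha> Xs = lie_d X (lie_d Y \<alpha>) Xs - lie_d Y (lie_d X \<alpha>) Xs"
  using assms
proof (induction Xs arbitrary: \<alpha>)
  case Nil
  then show ?case by (simp add: act_br cochain_N)
next
  case (Cons Z Zs)
  have *: "lie_d U (lie_d V \<alpha>) (Z # Zs) =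
      lie_d U (lie_d V (\<lambda>Zs. \<alpha> (Z # Zs))) Zs - lie_d U (\<lambda>Zs. \<alpha> (br V Z # Zs)) Zs
      - lie_d V (\<lambda>Zs. \<alpha> (br U Z # Zs)) Zs + \<alpha> (br V (br U Z) # Zs)"
    if "U \<in> L" "V \<in> L" for U V
  proof -
    have "lie_d U (\<lambda>Zs. lie_d V \<alpha> (Z # Zs)) Zs
        = lie_d U (lie_d V (\<lambda>Zs. \<alpha> (Z # Zs))) Zs - lie_d U (\<lambda>Zs. \<alpha> (br V Z # Zs)) Zs"
      unfolding lie_d_Cons using Cons.prems that
      by (intro lie_d_diff) (auto simp: N_lie_d cochain_insert cochain_N L_br)
    then show ?thesis by (simp add: lie_d_Cons)
  qed
  have "\<alpha> (br X (br Y Z) # Zs) = \<alpha> (br (br X Y) Z # Zs) + \<alpha> (br Y (br X Z) # Zs)"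
    using Cons.prems by (subst br_br) (simp_all add: cochain_add_first L_br)
  moreover have "lie_d (br X Y) \<alpha> (Z # Zs) = lie_d X (lie_d Y (\<lambda>Zs. \<alpha> (Z # Zs))) Zs
      - lie_d Y (lie_d X (\<lambda>Zs. \<alpha> (Z # Zs))) Zs - \<alpha> (br (br X Y) Z # Zs)"
    using Cons.IH[of "\<lambda>Zs. \<alpha> (Z # Zs)"] Cons.prems
    by (simp add: lie_d_Cons cochain_insert)
  ultimately show ?case
    using Cons.prems by (simp add: *)
qed

lemma ce_d_Nil [simp]: "ce_d \<alpha> [] = 0"
  by (simp add: ce_d_def)

text \<open>
  Cartan's formula \<open>\<iota>\<^sub>X d = \<L>\<^sub>X - d \<iota>\<^sub>X\<close>.  In the differential at \<open>X # Xs\<close>, the terms that single out \<open>X\<close>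
  make up the Lie derivative once each bracket \<open>[X, Xs ! j]\<close> is moved from the front to place \<open>j\<close>, which
  absorbs the sign; in the other terms \<open>X\<close> is moved to the front, which changes the sign.
\<close>
lemma ce_d_Cons:
  assumes "cochain \<alpha>" "X \<in> L" "set Xs \<subseteq> L"
  shows "ce_d \<alpha> (X # Xs) = lie_d X \<alpha> Xs - ce_d (\<lambda>Ys. \<alpha> (X # Ys)) Xs"
proof -
  have [simp]: "nths (X # Xs) (- {0}) = Xs" "nths (X # Xs) (- {Suc i}) = X # nths Xs (- {i})"
    "nths (X # Xs) (- {0, Suc i}) = nths Xs (- {i})"
    "nths (X # Xs) (- {Suc i, Suc j}) = X # nths Xs (- {i, j})" for i j
    by (auto simp: nths_Cons Compl_eq nths_UNIV)
  have to_front: "alt_sign j (\<alpha> (br X (Xs ! j) # nths Xs (- {j}))) = \<alpha> (Xs[j := br X (Xs ! j)])"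
    if "j < length Xs" for j
  proof -
    have "Xs ! j \<in> L" using that assms(3) by auto
    then have "\<alpha> (take j Xs @ br X (Xs ! j) # drop (Suc j) Xs)
        = alt_sign j (\<alpha> (br X (Xs ! j) # nths Xs (- {j})))"
      using assms that cochain_move[of \<alpha> "take j Xs" "br X (Xs ! j)" "drop (Suc j) Xs"]
        set_take_subset[of j Xs] set_drop_subset[of "Suc j" Xs]
      by (simp add: L_br nths_omit_one min_def subset_iff)
    then show ?thesis using that by (simp add: upd_conv_take_nth_drop)
  qed
  have swap: "\<alpha> (br (Xs ! i) (Xs ! j) # X # nths Xs (- {i, j}))
      = - \<alpha> (X # br (Xs ! i) (Xs ! j) # nths Xs (- {i, j}))" if "j < length Xs" "i < j" for i j
  proof -
    have "Xs ! i \<in> L" "Xs ! j \<in> L" using that assms(3) by auto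
    then show ?thesis
      using assms cochain_swap[of \<alpha> "[]" "br (Xs ! i) (Xs ! j)" X "nths Xs (- {i, j})"]
      by (simp add: L_br nths_subset)
  qed
  have "(\<Sum>j<Suc (length Xs). \<Sum>i<j. alt_sign (i + j)
          (\<alpha> (br ((X # Xs) ! i) ((X # Xs) ! j) # nths (X # Xs) (- {i, j}))))
      = (\<Sum>j<length Xs. - \<alpha> (Xs[j := br X (Xs ! j)]) - (\<Sum>i<j. alt_sign (i + j)
          (\<alpha> (X # br (Xs ! i) (Xs ! j) # nths Xs (- {i, j})))))"
    by (subst sum.lessThan_Suc_shift)
      (auto simp: sum.lessThan_Suc_shift to_front swap sum_negf intro!: sum.cong simp del: sum.lessThan_Suc)
  moreover have "(\<Sum>i<Suc (length Xs). alt_sign i (act ((X # Xs) ! i) (\<alpha> (nths (X # Xs) (- {i})))))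
      = act X (\<alpha> Xs) - (\<Sum>i<length Xs. alt_sign i (act (Xs ! i) (\<alpha> (X # nths Xs (- {i})))))"
    by (subst sum.lessThan_Suc_shift) (simp add: sum_negf)
  ultimately show ?thesis
    by (simp add: ce_d_def lie_d_def sum_subtractf sum_negf del: sum.lessThan_Suc)
qed

text \<open>
  Induction on the arguments.  By Cartan's formula and \<open>lie_d_Cons\<close>, the contraction with \<open>Y\<close> of
  \<open>\<L>\<^sub>X d - d \<L>\<^sub>X\<close> is \<open>\<L>\<^sub>X \<L>\<^sub>Y - \<L>\<^sub>Y \<L>\<^sub>X - \<L>\<^bsub>[X,Y]\<^esub>\<close> applied to \<open>\<alpha>\<close>, minus \<open>\<L>\<^sub>X d - d \<L>\<^sub>X\<close>
  applied to \<open>\<iota>\<^sub>Y \<alpha>\<close>; the former is zero by \<open>lie_d_bracket\<close>, the latter by induction.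
\<close>
lemma lie_d_ce_d_commute:
  assumes "cochain \<alpha>" "X \<in> L" "set Xs \<subseteq> L"
  shows "lie_d X (ce_d \<alpha>) Xs = ce_d (lie_d X \<alpha>) Xs"
  using assms
proof (induction Xs arbitrary: \<alpha>)
  case Nil
  then show ?case by (simp add: act_0)
next
  case (Cons Y Ys)
  note [simp] = cochain_insert cochain_lie_d L_br
  have prems [simp]: "cochain \<alpha>" "X \<in> L" "Y \<in> L" "set Ys \<subseteq> L" using Cons.prems by auto
  let ?\<iota> = "\<lambda>Ys. \<alpha> (Y # Ys)"
  have "lie_d X (\<lambda>Zs. ce_d \<alpha> (Y # Zs)) Ys = lie_d X (\<lambda>Zs. lie_d Y \<alpha> Zs - ce_d ?\<iota> Zs) Ys"
    by (intro lie_d_cong) (auto simp: ce_d_Cons)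
  also have "\<dots> = lie_d X (lie_d Y \<alpha>) Ys - lie_d X (ce_d ?\<iota>) Ys"
    by (intro lie_d_diff) (auto simp: N_lie_d N_ce_d)
  also have "lie_d X (ce_d ?\<iota>) Ys = ce_d (lie_d X ?\<iota>) Ys"
    by (intro Cons.IH) auto
  finally have 1: "lie_d X (ce_d \<alpha>) (Y # Ys)
      = lie_d X (lie_d Y \<alpha>) Ys - ce_d (lie_d X ?\<iota>) Ys
        - lie_d (br X Y) \<alpha> Ys + ce_d (\<lambda>Zs. \<alpha> (br X Y # Zs)) Ys"
    by (simp add: lie_d_Cons ce_d_Cons)
  have "ce_d (\<lambda>Zs. lie_d X \<alpha> (Y # Zs)) Ys
      = ce_d (lie_d X ?\<iota>) Ys - ce_d (\<lambda>Zs. \<alpha> (br X Y # Zs)) Ys"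
    unfolding lie_d_Cons by (intro ce_d_diff) (auto simp: N_lie_d cochain_N)
  then show ?case
    unfolding 1 by (simp add: ce_d_Cons lie_d_bracket)
qed

text \<open>
  Read off from Cartan's formula, which expresses the differential through a Lie derivative and the
  differential of a contraction.  For alternation in the first two places, contract twice with the
  same \<open>Y\<close>: the two copies of \<open>\<L>\<^sub>Y \<iota>\<^sub>Y \<alpha>\<close> cancel, and the remaining terms contain \<open>[Y, Y]\<close> or
  \<open>\<iota>\<^sub>Y \<iota>\<^sub>Y \<alpha>\<close>.
\<close>
lemma cochain_ce_d:
  assumes "cochain \<alpha>"
  shows "cochain (ce_d \<alpha>)"
  unfolding cochain_def
proof (intro conjI allI impI; (elim conjE)?)
  fix Xs assume "set Xs \<subseteq> L"
  then show "ce_d \<alpha> Xs \<in> N" using assms by (simp add: N_ce_d)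
next
  fix As Y Z Bs assume "set As \<subseteq> L" "Y \<in> L" "Z \<in> L" "set Bs \<subseteq> L"
  then show "ce_d \<alpha> (As @ (Y + Z) # Bs) = ce_d \<alpha> (As @ Y # Bs) + ce_d \<alpha> (As @ Z # Bs)"
    using assms
  proof (induction As arbitrary: \<alpha>)
    case Nil
    have "ce_d (\<lambda>Zs. \<alpha> ((Y + Z) # Zs)) Bs = ce_d (\<lambda>Zs. \<alpha> (Y # Zs) + \<alpha> (Z # Zs)) Bs"
      using Nil by (intro ce_d_cong) (auto simp: cochain_add_first)
    also have "\<dots> = ce_d (\<lambda>Zs. \<alpha> (Y # Zs)) Bs + ce_d (\<lambda>Zs. \<alpha> (Z # Zs)) Bs"
      using Nil by (intro ce_d_add) (auto simp: cochain_N)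
    finally show ?case
      using Nil by (simp add: ce_d_Cons lie_d_add_left L_add)
  next
    case (Cons A As)
    then show ?case
      using Cons.IH[of "\<lambda>Zs. \<alpha> (A # Zs)"] cochain_add[of "lie_d A \<alpha>" As Y Z Bs]
      by (simp add: ce_d_Cons cochain_insert cochain_lie_d L_add)
  qed
next
  fix As Y Bs assume "set As \<subseteq> L" "Y \<in> L" "set Bs \<subseteq> L"
  then show "ce_d \<alpha> (As @ Y # Y # Bs) = 0"
    using assms
  proof (induction As arbitrary: \<alpha>)
    case Nil
    have "ce_d (\<lambda>Zs. \<alpha> (Y # Y # Zs)) Bs = ce_d (\<lambda>Zs. 0) Bs"
      using Nil cochain_repeat[of \<alpha> "[]"] by (intro ce_d_cong) auto
    then show ?case
      using Nil by (simp add: ce_d_Cons ce_d_0 cochain_insert lie_d_Cons br_self cochain_zero_first)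
  next
    case (Cons A As)
    then show ?case
      using Cons.IH[of "\<lambda>Zs. \<alpha> (A # Zs)"] cochain_repeat[of "lie_d A \<alpha>" As Y Bs]
      by (simp add: ce_d_Cons cochain_insert cochain_lie_d)
  qed
qed

text \<open>
  By Cartan's formula \<open>\<iota>\<^sub>X d d = \<L>\<^sub>X d - d \<L>\<^sub>X + d d \<iota>\<^sub>X\<close>; the first two terms cancel, and the last one
  is zero by induction.
\<close>
lemma ce_d_ce_d:
  assumes "cochain \<alpha>" "set Xs \<subseteq> L"
  shows "ce_d (ce_d \<alpha>) Xs = 0"
  using assms
proof (induction Xs arbitrary: \<alpha>)
  case (Cons X Xs)
  have "ce_d (\<lambda>Ys. ce_d \<alpha> (X # Ys)) Xs = ce_d (\<lambda>Ys. lie_d X \<alpha> Ys - ce_d (\<lambda>Ys. \<alpha> (X # Ys)) Ys) Xs"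
    using Cons.prems by (intro ce_d_cong) (auto simp: ce_d_Cons)
  also have "\<dots> = ce_d (lie_d X \<alpha>) Xs - ce_d (ce_d (\<lambda>Ys. \<alpha> (X # Ys))) Xs"
    using Cons.prems by (intro ce_d_diff) (auto simp: N_lie_d N_ce_d cochain_insert)
  also have "ce_d (ce_d (\<lambda>Ys. \<alpha> (X # Ys))) Xs = 0"
    using Cons by (simp add: cochain_insert)
  finally show ?case
    using Cons.prems by (simp add: ce_d_Cons cochain_ce_d lie_d_ce_d_commute)
qed simp

end

section \<open>The algebra of smooth functions\<close>

text \<open>
  This makes partial derivatives at a point of \<open>V\<close> depend only on the values of a function on \<open>V\<close>.
\<close>
lemma eventually_update_in_open:
  assumes "openin (Euclidean_space d) V" "x \<in> V" "i < d"
  shows "\<forall>\<^sub>F t in nhds (x i). x(i := t) \<in> V"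
proof -
  obtain T where T: "openin (powertop_real UNIV) T" "V = T \<inter> {x. \<forall>i\<ge>d. x i = 0}"
    using assms(1) by (auto simp: Euclidean_space_def openin_subtopology)
  have "continuous_map euclideanreal (powertop_real UNIV) (\<lambda>t. x(i := t))"
    by (simp add: continuous_map_componentwise_UNIV fun_upd_def)
  from openin_continuous_map_preimage[OF this T(1)]
  have "open {t. x(i := t) \<in> T}" by simp
  moreover have "x i \<in> {t. x(i := t) \<in> T}" using assms(2) T(2) by simp
  ultimately have "\<forall>\<^sub>F t in nhds (x i). x(i := t) \<in> T"
    using eventually_nhds_in_open by fastforce
  then show ?thesis
    by eventually_elim (use assms T(2) in auto)
qed

lemma partial_deriv_cong:
  assumes V: "openin (Euclidean_space d) V" "x \<in> V" "i < d"
    and eq: "\<And>y. y \<in> V \<Longrightarrow> f y = g y"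
  shows "(\<lambda>t. f (x(i := t))) field_differentiable at (x i) \<longleftrightarrow>
           (\<lambda>t. g (x(i := t))) field_differentiable at (x i)"
    and "partial_deriv i f x = partial_deriv i g x"
proof -
  have *: "\<forall>\<^sub>F t in nhds (x i). f (x(i := t)) = g (x(i := t))"
    using eventually_update_in_open[OF V] by eventually_elim (rule eq)
  show "(\<lambda>t. f (x(i := t))) field_differentiable at (x i) \<longleftrightarrow>
           (\<lambda>t. g (x(i := t))) field_differentiable at (x i)"
    unfolding field_differentiable_def using DERIV_cong_ev[OF refl * refl] by simp
  show "partial_deriv i f x = partial_deriv i g x"
    unfolding partial_deriv_def by (rule deriv_cong_ev[OF * refl])
qed

text \<open>
  The sum and product rules for \<open>partial_deriv\<close> hold only where the functions are differentiable,
  hence only on \<open>V\<close>; this lemma allows rewriting with them under \<open>Ck_on\<close>.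
\<close>
lemma Ck_on_cong:
  assumes V: "openin (Euclidean_space d) V" and eq: "\<And>y. y \<in> V \<Longrightarrow> f y = g y"
    and f: "Ck_on d V k f"
  shows "Ck_on d V k g"
  using eq f
proof (induction k arbitrary: f g)
  case 0
  then show ?case by (auto elim!: continuous_map_eq)
next
  case (Suc k)
  have "continuous_map (subtopology (Euclidean_space d) V) euclideanreal g"
    using Suc.prems by (auto elim!: continuous_map_eq)
  moreover have "(\<lambda>t. g (x(i := t))) field_differentiable at (x i)" if "i < d" "x \<in> V" for i x
    using Suc.prems partial_deriv_cong(1)[OF V that(2,1), of f g] that by simp
  moreover have "Ck_on d V k (partial_deriv i g)" if "i < d" for i
    using Suc.IH[of "partial_deriv i f"] Suc.prems partial_deriv_cong(2)[OF V _ that, of _ f g] that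
    by simp
  ultimately show ?case by simp
qed

lemma Ck_on_SucD: "Ck_on d V (Suc k) f \<Longrightarrow> Ck_on d V k f"
  by (induction k arbitrary: f) auto

lemma Ck_on_add:
  assumes "openin (Euclidean_space d) V" "Ck_on d V k f" "Ck_on d V k g"
  shows "Ck_on d V k (\<lambda>x. f x + g x)"
  using assms(2,3)
proof (induction k arbitrary: f g)
  case 0
  then show ?case by (auto intro: continuous_map_add)
next
  case (Suc k)
  have "Ck_on d V k (partial_deriv i (\<lambda>x. f x + g x))" if "i < d" for i
  proof (rule Ck_on_cong[OF assms(1)])
    show "Ck_on d V k (\<lambda>x. partial_deriv i f x + partial_deriv i g x)"
      using Suc that by simp
    show "partial_deriv i f x + partial_deriv i g x = partial_deriv i (\<lambda>x. f x + g x) x" if "x \<in> V" for x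
      unfolding partial_deriv_def using Suc.prems \<open>i < d\<close> that by (subst deriv_add) auto
  qed
  then show ?case
    using Suc.prems by (auto intro: continuous_map_add field_differentiable_add)
qed

lemma Ck_on_mult:
  assumes "openin (Euclidean_space d) V" "Ck_on d V k f" "Ck_on d V k g"
  shows "Ck_on d V k (\<lambda>x. f x * g x)"
  using assms(2,3)
proof (induction k arbitrary: f g)
  case 0
  then show ?case by (auto intro: continuous_map_real_mult)
next
  case (Suc k)
  have "Ck_on d V k (partial_deriv i (\<lambda>x. f x * g x))" if "i < d" for i
  proof (rule Ck_on_cong[OF assms(1)])
    show "Ck_on d V k (\<lambda>x. f x * partial_deriv i g x + partial_deriv i f x * g x)"
      using Suc.prems that
      by (intro Ck_on_add[OF assms(1)] Suc.IH Ck_on_SucD[of d V k f] Ck_on_SucD[of d V k g]) auto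
    show "f x * partial_deriv i g x + partial_deriv i f x * g x = partial_deriv i (\<lambda>x. f x * g x) x"
      if "x \<in> V" for x
      unfolding partial_deriv_def using Suc.prems \<open>i < d\<close> that by (subst deriv_mult) auto
  qed
  then show ?case
    using Suc.prems by (auto intro: continuous_map_real_mult field_differentiable_mult)
qed

lemma Ck_on_const: "Ck_on d V k (\<lambda>x. c)"
proof (induction k arbitrary: c)
  case (Suc k)
  have "partial_deriv i (\<lambda>x. c) = (\<lambda>x. 0)" for i
    by (simp add: partial_deriv_def fun_eq_iff)
  with Suc show ?case by simp
qed simp

lemma chart_image_open:
  "\<lbrakk>smooth_manifold d A; (U, \<phi>) \<in> A\<rbrakk> \<Longrightarrow> openin (Euclidean_space d) (\<phi> ` U)"
  by (auto simp: smooth_manifold_def)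

lemma smooth_functions_add:
  assumes "smooth_manifold d A" "f \<in> smooth_functions d A" "g \<in> smooth_functions d A"
  shows "f + g \<in> smooth_functions d A"
  using assms
  by (fastforce simp: smooth_functions_def smooth_on_def intro!: Ck_on_add chart_image_open)

lemma smooth_functions_mult:
  assumes "smooth_manifold d A" "f \<in> smooth_functions d A" "g \<in> smooth_functions d A"
  shows "f * g \<in> smooth_functions d A"
  using assms
  by (fastforce simp: smooth_functions_def smooth_on_def intro!: Ck_on_mult chart_image_open)

lemma smooth_functions_const: "(\<lambda>m. c) \<in> smooth_functions d A"
  by (auto simp: smooth_functions_def smooth_on_def Ck_on_const)

section \<open>Lie algebra homology as an instance of the calculus\<close>

lemma wedge_add: "wedge (xs @ (x + y) # ys) = wedge (xs @ x # ys) + wedge (xs @ y # ys)"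
proof -
  have "Poly_Mapping.single (xs @ (x + y) # ys) 1 - Poly_Mapping.single (xs @ x # ys) 1
      - Poly_Mapping.single (xs @ y # ys) 1 \<in> span (ext_relators :: ('a list, real) poly_mapping set)"
    by (rule span_base) (unfold ext_relators_def, blast)
  then show ?thesis
    by (simp add: wedge_def plus_ext_algebra.abs_eq ext_algebra.abs_eq_iff ext_equiv_def diff_diff_eq)
qed

lemma wedge_scaleR: "wedge (xs @ (c *\<^sub>R x) # ys) = c *\<^sub>R wedge (xs @ x # ys)"
proof -
  have "Poly_Mapping.single (xs @ (c *\<^sub>R x) # ys) 1 - c *\<^sub>R Poly_Mapping.single (xs @ x # ys) 1
      \<in> span (ext_relators :: ('a list, real) poly_mapping set)"
    by (rule span_base) (unfold ext_relators_def, blast)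
  then show ?thesis
    by (simp add: wedge_def scaleR_ext_algebra.abs_eq ext_algebra.abs_eq_iff ext_equiv_def)
qed

lemma wedge_not_distinct: "\<not> distinct xs \<Longrightarrow> wedge xs = 0"
proof -
  assume "\<not> distinct xs"
  then have "Poly_Mapping.single xs 1 - 0 \<in> span (ext_relators :: ('a list, real) poly_mapping set)"
    unfolding diff_0_right by (intro span_base) (auto simp: ext_relators_def)
  then show ?thesis
    by (simp add: wedge_def zero_ext_algebra.abs_eq ext_algebra.abs_eq_iff ext_equiv_def)
qed

text \<open>
  The Lie algebra acts on its exterior algebra by zero, not by the adjoint action: then only the
  bracket terms of \<open>ce_d\<close> survive, and they are those of \<open>lie_boundary\<close>.
\<close>
locale lie_algebra_homology =
  fixes br :: "'g::real_vector \<Rightarrow> 'g \<Rightarrow> 'g"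
  assumes lie: "lie_algebra br"
begin

lemma bilinear: "bilinear br"
  using lie by (simp add: lie_algebra_def)

sublocale lie_module UNIV br UNIV "\<lambda>_ _. 0 :: 'g ext_algebra"
proof
  have self: "br x x = 0" for x using lie by (simp add: lie_algebra_def)
  have skew: "br x y = - br y x" for x y
  proof -
    have "br (x + y) (x + y) = br x y + br y x"
      by (simp add: bilinear_ladd[OF bilinear] bilinear_radd[OF bilinear] self[of x] self[of y])
    then show ?thesis by (simp only: self[of "x + y"] eq_neg_iff_add_eq_0)
  qed
  fix x y z
  have "br x (br y z) + br y (br z x) + br z (br x y) = 0"
    using lie by (simp add: lie_algebra_def)
  moreover have "br y (br z x) = - br y (br x z)"
    by (simp add: skew[of z x] bilinear_rneg[OF bilinear])
  moreover have "br z (br x y) = - br (br x y) z" by (rule skew)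
  ultimately show "br x (br y z) = br (br x y) z + br y (br x z)"
    by (simp add: algebra_simps)
  show "br x x = 0" by (rule self)
qed (auto simp: bilinear_ladd[OF bilinear] bilinear_radd[OF bilinear])

lemma lie_d_scaleR: "lie_d x (\<lambda>xs. c *\<^sub>R \<alpha> xs) xs = c *\<^sub>R lie_d x \<alpha> xs"
  by (simp add: lie_d_def scaleR_sum_right)

lemma alt_sign_scaleR: "alt_sign n (c *\<^sub>R (x :: 'b::real_vector)) = c *\<^sub>R alt_sign n x"
  by (simp add: alt_sign_def)

lemma ce_d_scaleR: "ce_d (\<lambda>xs. c *\<^sub>R \<alpha> xs) xs = c *\<^sub>R ce_d \<alpha> xs"
  by (simp add: ce_d_def scaleR_sum_right alt_sign_scaleR)

lemma lie_d_homogeneous: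
  assumes "\<And>as y bs. \<alpha> (as @ (c *\<^sub>R y) # bs) = c *\<^sub>R \<alpha> (as @ y # bs)"
  shows "lie_d x \<alpha> (as @ (c *\<^sub>R y) # bs) = c *\<^sub>R lie_d x \<alpha> (as @ y # bs)"
  using assms
proof (induction as arbitrary: \<alpha>)
  case Nil
  have "\<alpha> ((c *\<^sub>R y) # zs) = c *\<^sub>R \<alpha> (y # zs)" for y zs
    using Nil[of "[]"] by simp
  then show ?case
    by (simp add: lie_d_Cons lie_d_scaleR bilinear_rmul[OF bilinear] scaleR_diff_right)
next
  case (Cons a as)
  have "\<alpha> (z # as @ (c *\<^sub>R y) # bs) = c *\<^sub>R \<alpha> (z # as @ y # bs)" for z as y bs
    using Cons.prems[of "z # as"] by simp
  then show ?case
    using Cons.IH[of "\<lambda>zs. \<alpha> (a # zs)"] by (simp add: lie_d_Cons scaleR_diff_right)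
qed

lemma lie_d_scaleR_left:
  assumes "\<And>as y bs. \<alpha> (as @ (c *\<^sub>R y) # bs) = c *\<^sub>R \<alpha> (as @ y # bs)"
  shows "lie_d (c *\<^sub>R x) \<alpha> xs = c *\<^sub>R lie_d x \<alpha> xs"
proof -
  have "\<alpha> (xs[i := br (c *\<^sub>R x) (xs ! i)]) = c *\<^sub>R \<alpha> (xs[i := br x (xs ! i)])" if "i < length xs" for i
    using that assms[of "take i xs"]
    by (simp add: upd_conv_take_nth_drop bilinear_lmul[OF bilinear])
  then show ?thesis
    by (simp add: lie_d_def scaleR_sum_right)
qed

text \<open>
  Cochains are only additive in each place.  Homogeneity passes to the differential by the same
  induction as additivity.
\<close>
lemma ce_d_homogeneous:
  assumes "cochain \<alpha>" "\<And>as y bs. \<alpha> (as @ (c *\<^sub>R y) # bs) = c *\<^sub>R \<alpha> (as @ y # bs)"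
  shows "ce_d \<alpha> (as @ (c *\<^sub>R y) # bs) = c *\<^sub>R ce_d \<alpha> (as @ y # bs)"
  using assms
proof (induction as arbitrary: \<alpha>)
  case Nil
  have "\<alpha> ((c *\<^sub>R y) # zs) = c *\<^sub>R \<alpha> (y # zs)" for y zs
    using Nil(2)[of "[]"] by simp
  with Nil show ?case
    by (simp add: ce_d_Cons ce_d_scaleR lie_d_scaleR_left scaleR_diff_right)
next
  case (Cons a as)
  have "\<alpha> (z # as @ (c *\<^sub>R y) # bs) = c *\<^sub>R \<alpha> (z # as @ y # bs)" for z as y bs
    using Cons.prems(2)[of "z # as"] by simp
  with Cons.prems Cons.IH[of "\<lambda>zs. \<alpha> (a # zs)"] show ?case
    by (simp add: ce_d_Cons scaleR_diff_right cochain_insert lie_d_homogeneous)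
qed

lemma cochain_wedge: "cochain wedge"
  by (simp add: cochain_def wedge_add wedge_not_distinct)

lemma lie_boundary_eq: "lie_boundary br = ext_lift (ce_d wedge)"
proof -
  have "alt_sign (i + j) w = (-1) ^ (i + j) *\<^sub>R w" for i j and w :: "'g ext_algebra"
    by (cases "even (i + j)") (simp_all add: alt_sign_def)
  then have "ce_d wedge = (\<lambda>xs. \<Sum>j<length xs. \<Sum>i<j.
     (-1) ^ (i + j) *\<^sub>R wedge (br (xs ! i) (xs ! j) # nths xs (- {i, j})))"
    by (simp add: ce_d_def fun_eq_iff)
  then show ?thesis by (simp add: lie_boundary_def)
qed

lemma multilinear_alternating_ce_d_wedge: "multilinear_alternating (ce_d wedge)"
  unfolding multilinear_alternating_def
  using cochain_add[OF cochain_ce_d[OF cochain_wedge]]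
    ce_d_homogeneous[OF cochain_wedge wedge_scaleR]
    cochain_not_distinct[OF cochain_ce_d[OF cochain_wedge]]
  by (auto intro!: linearI)

lemma linear_lie_boundary: "linear (lie_boundary br)"
  by (simp add: lie_boundary_eq linear_ext_lift multilinear_alternating_ce_d_wedge)

lemma lie_boundary_wedge: "lie_boundary br (wedge xs) = ce_d wedge xs"
  by (simp add: lie_boundary_eq ext_lift_wedge multilinear_alternating_ce_d_wedge)

lemma linear_alt_sign: "linear h \<Longrightarrow> h (alt_sign n x) = alt_sign n (h x)"
  by (simp add: alt_sign_def linear_neg)

lemma linear_ce_d:
  assumes "linear h"
  shows "h (ce_d \<alpha> xs) = ce_d (\<lambda>ys. h (\<alpha> ys)) xs"
  by (simp add: ce_d_def linear_sum[OF assms] linear_alt_sign[OF assms])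

text \<open>
  The linear map \<open>\<partial>\<close> commutes with \<open>ce_d\<close>, as the action is zero; therefore \<open>\<partial>\<partial>\<close> of a wedge product is
  \<open>ce_d (ce_d wedge)\<close>.
\<close>
lemma lie_boundary_lie_boundary:
  assumes "q \<in> ext_power k"
  shows "lie_boundary br (lie_boundary br q) = 0"
proof -
  have "lie_boundary br (lie_boundary br (wedge xs)) = 0" for xs
    by (simp add: lie_boundary_wedge linear_ce_d[OF linear_lie_boundary] ce_d_ce_d[OF cochain_wedge])
  moreover have "linear (\<lambda>q. lie_boundary br (lie_boundary br q))"
    using linear_compose[OF linear_lie_boundary linear_lie_boundary] by (simp add: o_def)
  ultimately show ?thesis
    using assms linear_eq_0_on_span[of "\<lambda>q. lie_boundary br (lie_boundary br q)"]
    unfolding ext_power_def by blast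
qed

lemma lie_boundary_ext_power:
  assumes "q \<in> ext_power (Suc k)"
  shows "lie_boundary br q \<in> ext_power k"
proof -
  have "lie_boundary br (wedge xs) \<in> ext_power k" if "length xs = Suc k" for xs
  proof -
    have "wedge (br (xs ! i) (xs ! j) # nths xs (- {i, j})) \<in> ext_power k"
      if "j < length xs" "i < j" for i j
    proof -
      have "{l. l < length xs \<and> l \<in> - {i, j}} = {..<length xs} - {i, j}" by auto
      then have "length (nths xs (- {i, j})) = k - 1"
        using that \<open>length xs = Suc k\<close> by (simp add: length_nths card_Diff_subset)
      then show ?thesis
        unfolding ext_power_def using that \<open>length xs = Suc k\<close> by (intro span_base imageI) auto
    qed
    then show ?thesis
      unfolding lie_boundary_wedge ce_d_def ext_power_def
      by (intro span_add span_sum) (auto simp: alt_sign_def span_zero span_neg)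
  qed
  then have "wedge ` {xs. length xs = Suc k} \<subseteq> {q. lie_boundary br q \<in> ext_power k}" by auto
  moreover have "subspace {q. lie_boundary br q \<in> ext_power k}"
    using subspace_span linear_subspace_vimage[OF linear_lie_boundary, of "ext_power k"]
    by (auto simp: ext_power_def vimage_def)
  ultimately show ?thesis
    using assms span_minimal unfolding ext_power_def by blast
qed

lemma lie_boundaries_subset_cycles: "lie_boundaries br k \<subseteq> lie_cycles br k"
  by (auto simp: lie_boundaries_def lie_cycles_def lie_boundary_ext_power
      intro: lie_boundary_lie_boundary)

end

section \<open>Differential forms as cochains of the Lie algebra of vector fields\<close>

lemma sum_fun_apply: "(\<Sum>i\<in>I. F i) m = (\<Sum>i\<in>I. F i m)"
  by (induction I rule: infinite_finite_induct) auto

locale manifold =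
  fixes d :: nat and A :: "('m::{t2_space, second_countable_topology}) atlas"
  assumes smooth_manifold: "smooth_manifold d A"
begin

abbreviation "\<C> \<equiv> smooth_functions d A"
abbreviation "\<X> \<equiv> vector_fields d A"

lemmas smooth_add = smooth_functions_add[OF smooth_manifold]
lemmas smooth_mult = smooth_functions_mult[OF smooth_manifold]

lemma smooth_scale: "f \<in> \<C> \<Longrightarrow> (\<lambda>m. c * f m) \<in> \<C>"
  using smooth_mult[OF smooth_functions_const, of f c] by (simp add: times_fun_def)

lemma smooth_uminus: "f \<in> \<C> \<Longrightarrow> - f \<in> \<C>"
  using smooth_scale[of f "-1"] by (simp add: fun_Compl_def)

lemma smooth_diff: "f \<in> \<C> \<Longrightarrow> g \<in> \<C> \<Longrightarrow> f - g \<in> \<C>"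
  using smooth_add[of f "- g"] smooth_uminus by simp

lemma smooth_0: "0 \<in> \<C>"
  using smooth_functions_const[of 0] by (simp add: zero_fun_def)

lemma
  assumes "X \<in> \<X>"
  shows vf_smooth: "f \<in> \<C> \<Longrightarrow> X f \<in> \<C>"
    and vf_outside: "f \<notin> \<C> \<Longrightarrow> X f = 0"
    and vf_add: "\<lbrakk>f \<in> \<C>; g \<in> \<C>\<rbrakk> \<Longrightarrow> X (f + g) = X f + X g"
    and vf_scale: "f \<in> \<C> \<Longrightarrow> X (\<lambda>m. c * f m) = (\<lambda>m. c * X f m)"
    and vf_mult: "\<lbrakk>f \<in> \<C>; g \<in> \<C>\<rbrakk> \<Longrightarrow> X (f * g) = f * X g + X f * g"
  using assms by (auto simp: vector_fields_def)

lemma vf_uminus: "\<lbrakk>X \<in> \<X>; f \<in> \<C>\<rbrakk> \<Longrightarrow> X (- f) = - X f"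
  using vf_scale[of X f "-1"] by (simp add: fun_Compl_def)

lemma vf_diff: "\<lbrakk>X \<in> \<X>; f \<in> \<C>; g \<in> \<C>\<rbrakk> \<Longrightarrow> X (f - g) = X f - X g"
  by (metis add_uminus_conv_diff smooth_uminus vf_add vf_uminus)

lemma vf_0: "X \<in> \<X> \<Longrightarrow> X 0 = 0"
  by (metis diff_self smooth_0 vf_diff)

lemma vf_plus_closed: "\<lbrakk>X \<in> \<X>; Y \<in> \<X>\<rbrakk> \<Longrightarrow> X + Y \<in> \<X>"
  unfolding vector_fields_def by (auto simp: smooth_add algebra_simps fun_eq_iff)

lemma vf_mult_closed: "\<lbrakk>g \<in> \<C>; X \<in> \<X>\<rbrakk> \<Longrightarrow> (\<lambda>f. g * X f) \<in> \<X>"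
  unfolding vector_fields_def by (auto simp: smooth_mult algebra_simps fun_eq_iff)

lemma vf_bracket_closed: 
  assumes "X \<in> \<X>" "Y \<in> \<X>"
  shows "vf_bracket X Y \<in> \<X>"
  unfolding vector_fields_def vf_bracket_def mem_Collect_eq
proof (intro conjI ballI allI impI)
  note [simp] = vf_smooth[OF assms(1)] vf_smooth[OF assms(2)] smooth_diff smooth_mult
    vf_add[OF assms(1)] vf_add[OF assms(2)] vf_scale[OF assms(1)] vf_scale[OF assms(2)]
    vf_mult[OF assms(1)] vf_mult[OF assms(2)] vf_outside[OF assms(1)] vf_outside[OF assms(2)]
    vf_0[OF assms(1)] vf_0[OF assms(2)]
  fix f g :: "'m \<Rightarrow> real" and c :: real
  show "f \<in> \<C> \<Longrightarrow> X (Y f) - Y (X f) \<in> \<C>" by simp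
  show "f \<notin> \<C> \<Longrightarrow> X (Y f) - Y (X f) = 0" by simp
  assume [simp]: "f \<in> \<C>"
  show "X (Y (\<lambda>m. c * f m)) - Y (X (\<lambda>m. c * f m)) = (\<lambda>m. c * (X (Y f) - Y (X f)) m)"
    by (simp add: fun_eq_iff algebra_simps)
  assume [simp]: "g \<in> \<C>"
  show "X (Y (f + g)) - Y (X (f + g)) = X (Y f) - Y (X f) + (X (Y g) - Y (X g))"
    by simp
  show "X (Y (f * g)) - Y (X (f * g)) = f * (X (Y g) - Y (X g)) + (X (Y f) - Y (X f)) * g"
    by (simp add: algebra_simps)
qed

sublocale lie_module \<X> vf_bracket \<C> "\<lambda>X. X"
proof
  fix X Y Z assume [simp]: "X \<in> \<X>" "Y \<in> \<X>" "Z \<in> \<X>"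
  have smooth: "W f \<in> \<C>" if "W \<in> \<X>" for W f
    by (metis that vf_smooth vf_outside smooth_0)
  note [simp] = vf_add[of X] vf_add[of Y] vf_add[of Z] vf_diff[of X] vf_diff[of Y] vf_diff[of Z]
    smooth[of X] smooth[of Y] smooth[of Z]
  show "vf_bracket (X + Y) Z = vf_bracket X Z + vf_bracket Y Z"
    "vf_bracket X (Y + Z) = vf_bracket X Y + vf_bracket X Z"
    by (simp_all add: vf_bracket_def fun_eq_iff algebra_simps)
  show "vf_bracket X (vf_bracket Y Z) = vf_bracket (vf_bracket X Y) Z + vf_bracket Y (vf_bracket X Z)"
    by (simp add: vf_bracket_def fun_eq_iff)
  show "vf_bracket X X = 0" by (simp add: vf_bracket_def fun_eq_iff)
  show "X + Y \<in> \<X>" "vf_bracket X Y \<in> \<X>" by (simp_all add: vf_plus_closed vf_bracket_closed)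
  fix f g assume "f \<in> \<C>" "g \<in> \<C>"
  then show "X (f + g) = X f + X g" "X f \<in> \<C>"
    by simp_all
qed (simp_all add: smooth_0 smooth_add smooth_uminus vf_bracket_def)

text \<open>
  The Leibniz rule, which is what makes Lie derivatives of forms linear over smooth functions.
\<close>
lemma vf_bracket_mult:
  assumes "X \<in> \<X>" "Y \<in> \<X>" "g \<in> \<C>"
  shows "vf_bracket X (\<lambda>f. g * Y f) = (\<lambda>f. g * vf_bracket X Y f) + (\<lambda>f. X g * Y f)"
proof
  fix f
  show "vf_bracket X (\<lambda>f. g * Y f) f = ((\<lambda>f. g * vf_bracket X Y f) + (\<lambda>f. X g * Y f)) f"
  proof (cases "f \<in> \<C>")
    case True
    have "vf_bracket X (\<lambda>f. g * Y f) f = X (g * Y f) - g * Y (X f)" by (simp add: vf_bracket_def)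
    also have "X (g * Y f) = g * X (Y f) + X g * Y f"
      by (rule vf_mult[OF assms(1,3) vf_smooth[OF assms(2) True]])
    finally have eq: "vf_bracket X (\<lambda>f. g * Y f) f = g * X (Y f) + X g * Y f - g * Y (X f)" .
    show ?thesis
      unfolding eq plus_fun_apply unfolding vf_bracket_def by (rule ext) (simp add: algebra_simps)
  next
    case False
    have "X f = 0" "Y f = 0" "X 0 = 0" "Y 0 = 0"
      using False assms by (auto intro: vf_outside vf_0)
    then show ?thesis by (simp add: vf_bracket_def)
  qed
qed

text \<open>
  Translates the description of forms by places in a list of fixed length into the one by prefixes and
  suffixes on which the calculus rests.
\<close>
lemma forms_iff:
  "\<alpha> \<in> forms d A k \<longleftrightarrow>
     cochain \<alpha> \<and>
     (\<forall>Xs. \<not> (length Xs = k \<and> set Xs \<subseteq> \<X>) \<longrightarrow> \<alpha> Xs = 0) \<and>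
     (\<forall>As X Bs g. set As \<subseteq> \<X> \<and> X \<in> \<X> \<and> set Bs \<subseteq> \<X> \<and> g \<in> \<C> \<longrightarrow>
        \<alpha> (As @ (\<lambda>f. g * X f) # Bs) = g * \<alpha> (As @ X # Bs))"
    (is "_ \<longleftrightarrow> ?c \<and> ?o \<and> ?l")
proof (intro iffI conjI)
  assume \<alpha>: "\<alpha> \<in> forms d A k"
  show o: ?o using \<alpha> by (simp add: forms_def)
  show ?l
  proof (intro allI impI; elim conjE)
    fix As X Bs g assume *: "set As \<subseteq> \<X>" "X \<in> \<X>" "set Bs \<subseteq> \<X>" "g \<in> \<C>"
    show "\<alpha> (As @ (\<lambda>f. g * X f) # Bs) = g * \<alpha> (As @ X # Bs)"
    proof (cases "length (As @ X # Bs) = k")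
      case True
      have "\<forall>Xs i X g. length Xs = k \<and> set Xs \<subseteq> \<X> \<and> i < k \<and> X \<in> \<X> \<and> g \<in> \<C> \<longrightarrow>
          \<alpha> (Xs[i := (\<lambda>f. g * X f)]) = g * \<alpha> (Xs[i := X])"
        using \<alpha> by (simp add: forms_def)
      from this[rule_format, of "As @ X # Bs" "length As" X g] show ?thesis using * True by auto
    next
      case False
      then show ?thesis using o[rule_format, of "As @ X # Bs"] o[rule_format, of "As @ (\<lambda>f. g * X f) # Bs"] by simp
    qed
  qed
  show ?c
    unfolding cochain_def
  proof (intro conjI allI impI; (elim conjE)?)
    fix Xs assume "set Xs \<subseteq> \<X>"
    then show "\<alpha> Xs \<in> \<C>"
      using \<alpha> by (cases "length Xs = k") (auto simp: forms_def smooth_0)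
  next
    fix As X Y Bs assume *: "set As \<subseteq> \<X>" "X \<in> \<X>" "Y \<in> \<X>" "set Bs \<subseteq> \<X>"
    show "\<alpha> (As @ (X + Y) # Bs) = \<alpha> (As @ X # Bs) + \<alpha> (As @ Y # Bs)"
    proof (cases "length (As @ X # Bs) = k")
      case True
      have "\<forall>Xs i X Y. length Xs = k \<and> set Xs \<subseteq> \<X> \<and> i < k \<and> X \<in> \<X> \<and> Y \<in> \<X> \<longrightarrow>
          \<alpha> (Xs[i := X + Y]) = \<alpha> (Xs[i := X]) + \<alpha> (Xs[i := Y])"
        using \<alpha> by (simp add: forms_def)
      from this[rule_format, of "As @ X # Bs" "length As" X Y] show ?thesis using * True by auto
    next
      case False
      then show ?thesis using o[rule_format, of "As @ _ # Bs"] by simp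
    qed
  next
    fix As X Bs assume *: "set As \<subseteq> \<X>" "X \<in> \<X>" "set Bs \<subseteq> \<X>"
    show "\<alpha> (As @ X # X # Bs) = 0"
    proof (cases "length (As @ X # X # Bs) = k")
      case True
      have "\<forall>Xs i j. length Xs = k \<and> set Xs \<subseteq> \<X> \<and> i < j \<and> j < k \<and> Xs ! i = Xs ! j \<longrightarrow> \<alpha> Xs = 0"
        using \<alpha> by (simp add: forms_def)
      from this[rule_format, of "As @ X # X # Bs" "length As" "Suc (length As)"]
      show ?thesis using * True by (auto simp: nth_append)
    next
      case False
      then show ?thesis using o by blast
    qed
  qed
next
  assume *: "?c \<and> ?o \<and> ?l"
  then have c: ?c and l: ?l by blast+
  show "\<alpha> \<in> forms d A k"
    unfolding forms_def mem_Collect_eq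
  proof (intro conjI allI impI; (elim conjE)?)
    fix Xs show "length Xs = k \<Longrightarrow> set Xs \<subseteq> \<X> \<Longrightarrow> \<alpha> Xs \<in> \<C>" using c by (simp add: cochain_N)
    show "\<not> (length Xs = k \<and> set Xs \<subseteq> \<X>) \<Longrightarrow> \<alpha> Xs = 0" using * by blast
    fix i X assume Xs: "length Xs = k" "set Xs \<subseteq> \<X>"
    show "\<alpha> Xs = 0" if "i < j" "j < k" "Xs ! i = Xs ! j" for j
    proof (rule cochain_not_distinct[OF c Xs(2)])
      show "\<not> distinct Xs" using Xs(1) that by (metis distinct_conv_nth less_trans nat_neq_iff)
    qed
    assume i: "i < k" "X \<in> \<X>"
    have sub: "set (take i Xs) \<subseteq> \<X>" "set (drop (Suc i) Xs) \<subseteq> \<X>"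
      using Xs(2) set_take_subset set_drop_subset by fast+
    have upd: "Xs[i := Z] = take i Xs @ Z # drop (Suc i) Xs" for Z
      using Xs i by (simp add: upd_conv_take_nth_drop)
    show "\<alpha> (Xs[i := X + Y]) = \<alpha> (Xs[i := X]) + \<alpha> (Xs[i := Y])" if "Y \<in> \<X>" for Y
      unfolding upd by (rule cochain_add[OF c sub(1) i(2) that sub(2)])
    show "\<alpha> (Xs[i := (\<lambda>f. g * X f)]) = g * \<alpha> (Xs[i := X])" if "g \<in> \<C>" for g
      unfolding upd using i that sub l by blast
  qed
qed

lemma forms_cochain: "\<alpha> \<in> forms d A k \<Longrightarrow> cochain \<alpha>"
  by (simp add: forms_iff)

lemma forms_outside:
  "\<lbrakk>\<alpha> \<in> forms d A k; \<not> (length Xs = k \<and> set Xs \<subseteq> \<X>)\<rbrakk> \<Longrightarrow> \<alpha> Xs = 0"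
  by (simp add: forms_iff)

lemma forms_mult:
  "\<lbrakk>\<alpha> \<in> forms d A k; set As \<subseteq> \<X>; X \<in> \<X>; set Bs \<subseteq> \<X>; g \<in> \<C>\<rbrakk> \<Longrightarrow>
     \<alpha> (As @ (\<lambda>f. g * X f) # Bs) = g * \<alpha> (As @ X # Bs)"
  by (simp add: forms_iff)

lemma lie_deriv_eq: "lie_deriv d A X \<alpha> Xs = (if set Xs \<subseteq> \<X> then lie_d X \<alpha> Xs else 0)"
  by (simp add: lie_deriv_def lie_d_def)

lemma ext_deriv_eq: "ext_deriv d A \<alpha> Xs = (if set Xs \<subseteq> \<X> then ce_d \<alpha> Xs else 0)"
proof -
  have "(-1) ^ n * h m = alt_sign n h m" for n :: nat and h :: "'m \<Rightarrow> real" and m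
    by (simp add: alt_sign_def)
  then show ?thesis
    by (auto simp: ext_deriv_def ce_d_def sum_fun_apply fun_eq_iff[where 'a = 'm])
qed

lemma lie_d_mult:
  assumes "cochain \<alpha>" "X \<in> \<X>" "g \<in> \<C>" "set Xs \<subseteq> \<X>"
  shows "lie_d X (\<lambda>Ys. g * \<alpha> Ys) Xs = g * lie_d X \<alpha> Xs + X g * \<alpha> Xs"
proof -
  have "X (g * \<alpha> Xs) = g * X (\<alpha> Xs) + X g * \<alpha> Xs"
    by (rule vf_mult[OF assms(2,3) cochain_N[OF assms(1,4)]])
  then show ?thesis
    by (simp add: lie_d_def sum_fun_apply sum_distrib_left fun_eq_iff algebra_simps)
qed

text \<open>
  Only linearity over smooth functions needs an argument.  The term \<open>X g\<close> that arises from
  differentiating the value cancels against the one from the bracket \<open>[X, g Y]\<close>.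
\<close>
lemma lie_deriv_forms:
  assumes "\<alpha> \<in> forms d A k" "X \<in> \<X>"
  shows "lie_deriv d A X \<alpha> \<in> forms d A k"
proof -
  have mult: "lie_d X \<alpha> (As @ (\<lambda>f. g * Y f) # Bs) = g * lie_d X \<alpha> (As @ Y # Bs)"
    if "set As \<subseteq> \<X>" "Y \<in> \<X>" "set Bs \<subseteq> \<X>" "g \<in> \<C>" "cochain \<alpha>"
      "\<And>As Y Bs g. \<lbrakk>set As \<subseteq> \<X>; Y \<in> \<X>; set Bs \<subseteq> \<X>; g \<in> \<C>\<rbrakk> \<Longrightarrow>
        \<alpha> (As @ (\<lambda>f. g * Y f) # Bs) = g * \<alpha> (As @ Y # Bs)" for As Y Bs g \<alpha>
    using that
  proof (induction As arbitrary: \<alpha>)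
    case Nil
    have first: "\<alpha> ((\<lambda>f. h * Z f) # Zs) = h * \<alpha> (Z # Zs)" if "h \<in> \<C>" "Z \<in> \<X>" "set Zs \<subseteq> \<X>" for h Z Zs
      by (rule Nil(6)[of "[]", unfolded append_Nil]) (use that in auto)
    have "lie_d X (\<lambda>Zs. \<alpha> ((\<lambda>f. g * Y f) # Zs)) Bs = lie_d X (\<lambda>Zs. g * \<alpha> (Y # Zs)) Bs"
      using Nil assms(2) by (intro lie_d_cong) (auto simp: first)
    also have "\<dots> = g * lie_d X (\<lambda>Zs. \<alpha> (Y # Zs)) Bs + X g * \<alpha> (Y # Bs)"
      using Nil assms(2) by (intro lie_d_mult) (auto simp: cochain_insert)
    finally have lie: "lie_d X (\<lambda>Zs. \<alpha> ((\<lambda>f. g * Y f) # Zs)) Bs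
        = g * lie_d X (\<lambda>Zs. \<alpha> (Y # Zs)) Bs + X g * \<alpha> (Y # Bs)" .
    have "\<alpha> (vf_bracket X (\<lambda>f. g * Y f) # Bs)
        = \<alpha> ((\<lambda>f. g * vf_bracket X Y f) # Bs) + \<alpha> ((\<lambda>f. X g * Y f) # Bs)"
      unfolding vf_bracket_mult[OF assms(2) Nil(2,4)] using Nil assms(2)
      by (intro cochain_add_first vf_mult_closed L_br vf_smooth[OF assms(2)])
    also have "\<alpha> ((\<lambda>f. g * vf_bracket X Y f) # Bs) = g * \<alpha> (vf_bracket X Y # Bs)"
      by (rule first[OF Nil(4) L_br[OF assms(2) Nil(2)] Nil(3)])
    also have "\<alpha> ((\<lambda>f. X g * Y f) # Bs) = X g * \<alpha> (Y # Bs)"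
      by (rule first[OF vf_smooth[OF assms(2) Nil(4)] Nil(2,3)])
    finally have val: "\<alpha> (vf_bracket X (\<lambda>f. g * Y f) # Bs) = g * \<alpha> (vf_bracket X Y # Bs) + X g * \<alpha> (Y # Bs)" .
    show ?case
      unfolding append_Nil lie_d_Cons lie val by (rule ext) (simp add: algebra_simps)
  next
    case (Cons Z As)
    have "\<alpha> (W # As @ (\<lambda>f. g * Y f) # Bs) = g * \<alpha> (W # As @ Y # Bs)"
      if "W \<in> \<X>" "set As \<subseteq> \<X>" "Y \<in> \<X>" "set Bs \<subseteq> \<X>" "g \<in> \<C>" for W As Y Bs g
      by (rule Cons.prems(6)[of "W # As", unfolded append_Cons]) (use that in auto)
    note first = this
    have Z: "Z \<in> \<X>" using Cons.prems(1) by simp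
    have lie: "lie_d X (\<lambda>Zs. \<alpha> (Z # Zs)) (As @ (\<lambda>f. g * Y f) # Bs)
        = g * lie_d X (\<lambda>Zs. \<alpha> (Z # Zs)) (As @ Y # Bs)"
      by (rule Cons.IH[OF _ Cons.prems(2-4) cochain_insert[OF Cons.prems(5) Z] first[OF Z]])
        (use Cons.prems(1) in auto)
    have val: "\<alpha> (vf_bracket X Z # As @ (\<lambda>f. g * Y f) # Bs) = g * \<alpha> (vf_bracket X Z # As @ Y # Bs)"
      by (rule first) (use Cons.prems assms(2) in \<open>auto intro: L_br\<close>)
    show ?case
      unfolding append_Cons lie_d_Cons lie val by (rule ext) (simp add: algebra_simps)
  qed
  have "cochain (lie_deriv d A X \<alpha>)"
    using cochain_lie_d[OF forms_cochain[OF assms(1)] assms(2)]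
    by (simp add: cochain_def lie_deriv_eq L_add)
  moreover have "lie_deriv d A X \<alpha> Xs = 0" if "\<not> (length Xs = k \<and> set Xs \<subseteq> \<X>)" for Xs
  proof (cases "set Xs \<subseteq> \<X>")
    case True
    have zero: "\<alpha> Ys = 0" if "length Ys = length Xs" for Ys
      by (rule forms_outside[OF assms(1)]) (use True that \<open>\<not> (length Xs = k \<and> set Xs \<subseteq> \<X>)\<close> in auto)
    have "(\<Sum>i<length Xs. \<alpha> (Xs[i := vf_bracket X (Xs ! i)])) = 0"
      by (rule sum.neutral) (simp add: zero)
    with True show ?thesis
      by (simp only: lie_deriv_eq lie_d_def zero[OF refl] vf_0[OF assms(2)] diff_self if_True)
  qed (simp add: lie_deriv_eq)
  moreover have "lie_deriv d A X \<alpha> (As @ (\<lambda>f. g * Y f) # Bs) = g * lie_deriv d A X \<alpha> (As @ Y # Bs)"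
    if "set As \<subseteq> \<X>" "Y \<in> \<X>" "set Bs \<subseteq> \<X>" "g \<in> \<C>" for As Y Bs g
  proof -
    have "set (As @ (\<lambda>f. g * Y f) # Bs) \<subseteq> \<X>" "set (As @ Y # Bs) \<subseteq> \<X>"
      using that vf_mult_closed[OF that(4,2)] by auto
    then show ?thesis
      by (simp only: lie_deriv_eq if_True mult[OF that forms_cochain[OF assms(1)] forms_mult[OF assms(1)]])
  qed
  ultimately show ?thesis unfolding forms_iff by blast
qed

lemma forms_uminus: "\<alpha> \<in> forms d A k \<Longrightarrow> - \<alpha> \<in> forms d A k"
  by (simp add: forms_iff cochain_def smooth_uminus)

end

section \<open>Hamiltonian vector fields and contractions with a symmetry action\<close>

context manifold
begin

lemma contract_apply: "contract Vs \<alpha> Ys = \<alpha> (Vs @ Ys)"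
  by (induction Vs arbitrary: \<alpha>) (simp_all add: contract_def interior_product_def)

text \<open>
  The infinitesimal Liouville theorem: \<open>\<L>\<^sub>X \<omega> = d \<iota>\<^sub>X \<omega> = - d d H = 0\<close>.
\<close>
lemma lie_d_hamiltonian:
  assumes "cochain \<omega>" "closed_form d A \<omega>" "cochain H" "hamiltonian_vf d A \<omega> H X" "set Ys \<subseteq> \<X>"
  shows "lie_d X \<omega> Ys = 0"
proof -
  have X: "X \<in> \<X>" and dH: "ext_deriv d A H = - interior_product X \<omega>"
    using assms(4) by (auto simp: hamiltonian_vf_def)
  have \<iota>: "\<omega> (X # Zs) = - ce_d H Zs" if "set Zs \<subseteq> \<X>" for Zs
    using fun_cong[OF dH, of Zs] that ext_deriv_eq[of H Zs] by (simp add: interior_product_def)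
  have "ce_d (\<lambda>Zs. \<omega> (X # Zs)) Ys = ce_d (\<lambda>Zs. 0 - ce_d H Zs) Ys"
    using assms(5) by (intro ce_d_cong) (simp_all add: \<iota>)
  also have "\<dots> = ce_d (\<lambda>Zs. 0) Ys - ce_d (ce_d H) Ys"
    using assms(3,5) by (intro ce_d_diff) (simp_all add: smooth_0 N_ce_d)
  also have "\<dots> = 0"
    using assms(3,5) by (simp add: ce_d_0 ce_d_ce_d)
  finally have "ce_d (\<lambda>Zs. \<omega> (X # Zs)) Ys = 0" .
  moreover have "ce_d \<omega> (X # Ys) = 0"
    using assms(2,5) X ext_deriv_eq[of \<omega> "X # Ys"] by (simp add: closed_form_def)
  ultimately show ?thesis
    using ce_d_Cons[OF assms(1) X assms(5)] by simp
qed

text \<open>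
  As \<open>Y\<close> preserves \<open>\<omega>\<close>, \<open>\<iota>\<^bsub>[Y,X]\<^esub> \<omega> = \<L>\<^sub>Y \<iota>\<^sub>X \<omega> = - \<L>\<^sub>Y dH = - d \<L>\<^sub>Y H = 0\<close>.
\<close>
lemma bracket_contraction_zero:
  assumes "cochain \<omega>" "cochain H" "hamiltonian_vf d A \<omega> H X" "Y \<in> \<X>"
    and "lie_deriv d A Y \<omega> = 0" "closed_form d A (lie_deriv d A Y H)" "set Zs \<subseteq> \<X>"
  shows "\<omega> (vf_bracket X Y # Zs) = 0"
proof -
  have X: "X \<in> \<X>" and dH: "ext_deriv d A H = - interior_product X \<omega>"
    using assms(3) by (auto simp: hamiltonian_vf_def)
  have \<iota>: "\<omega> (X # Zs) = - ce_d H Zs" if "set Zs \<subseteq> \<X>" for Zs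
    using fun_cong[OF dH, of Zs] that ext_deriv_eq[of H Zs] by (simp add: interior_product_def)
  have "lie_d Y (\<lambda>Zs. \<omega> (X # Zs)) Zs = lie_d Y (\<lambda>Zs. 0 - ce_d H Zs) Zs"
    using assms(4,7) by (intro lie_d_cong) (simp_all add: \<iota>)
  also have "\<dots> = lie_d Y (\<lambda>Zs. 0) Zs - lie_d Y (ce_d H) Zs"
    using assms(2,4,7) by (intro lie_d_diff) (simp_all add: smooth_0 N_ce_d)
  also have "lie_d Y (\<lambda>Zs. 0) Zs = 0"
    using assms(4) by (rule lie_d_0)
  also have "lie_d Y (ce_d H) Zs = ce_d (lie_d Y H) Zs"
    using assms(2,4,7) by (rule lie_d_ce_d_commute)
  also have "\<dots> = ce_d (lie_deriv d A Y H) Zs"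
    using assms(7) by (intro ce_d_cong) (simp_all add: lie_deriv_eq)
  also have "\<dots> = 0"
    using assms(6,7) ext_deriv_eq[of "lie_deriv d A Y H" Zs] by (simp add: closed_form_def)
  finally have "lie_d Y (\<lambda>Zs. \<omega> (X # Zs)) Zs = 0" by (simp only: diff_self)
  moreover have "lie_d Y \<omega> (X # Zs) = 0"
    using assms(5,7) X lie_deriv_eq[of Y \<omega> "X # Zs"] by simp
  ultimately have "\<omega> (vf_bracket Y X # Zs) = 0"
    by (simp add: lie_d_Cons)
  moreover have "vf_bracket X Y + vf_bracket Y X = 0"
    by (simp add: vf_bracket_def fun_eq_iff)
  then have "\<omega> (vf_bracket X Y # Zs) + \<omega> (vf_bracket Y X # Zs) = 0"
    using cochain_add_first[OF assms(1) L_br[OF X assms(4)] L_br[OF assms(4) X] assms(7)]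
      cochain_zero_first[OF assms(1) X assms(7)] by (metis (no_types))
  ultimately show ?thesis by simp
qed

text \<open>
  Commute the Lie derivative past one contraction after the other.  Each commutator contracts
  \<open>\<alpha>\<close> with a bracket \<open>[X, V]\<close>, which can be moved to the front.
\<close>
lemma lie_d_contract:
  assumes "cochain \<alpha>" "X \<in> \<X>" "\<And>Ys. set Ys \<subseteq> \<X> \<Longrightarrow> lie_d X \<alpha> Ys = 0"
    and "\<And>V Ys. \<lbrakk>V \<in> set Vs; set Ys \<subseteq> \<X>\<rbrakk> \<Longrightarrow> \<alpha> (vf_bracket X V # Ys) = 0"
    and "set Vs \<subseteq> \<X>" "set Ys \<subseteq> \<X>"
  shows "lie_d X (\<lambda>Ys. \<alpha> (Vs @ Ys)) Ys = 0"
  using assms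
proof (induction Vs arbitrary: \<alpha>)
  case (Cons V Vs)
  have "lie_d X (\<lambda>Ys. (\<lambda>Ys. \<alpha> (V # Ys)) (Vs @ Ys)) Ys = 0"
  proof (rule Cons.IH)
    show "lie_d X (\<lambda>Ys. \<alpha> (V # Ys)) Ys = 0" if "set Ys \<subseteq> \<X>" for Ys
    proof -
      have "lie_d X \<alpha> (V # Ys) = 0"
        by (rule Cons.prems(3)) (use that Cons.prems(5) in auto)
      moreover have "\<alpha> (vf_bracket X V # Ys) = 0"
        by (rule Cons.prems(4)) (use that in auto)
      ultimately show ?thesis unfolding lie_d_Cons by (metis diff_0_right)
    qed
    show "\<alpha> (V # vf_bracket X W # Ys) = 0" if "W \<in> set Vs" "set Ys \<subseteq> \<X>" for W Ys
    proof -
      have W: "W \<in> \<X>" and V: "V \<in> \<X>" using that Cons.prems(5) by auto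
      have "\<alpha> (V # vf_bracket X W # Ys) = - \<alpha> (vf_bracket X W # V # Ys)"
        using cochain_swap[OF Cons.prems(1), of "[]" V "vf_bracket X W" Ys] that W V Cons.prems(2)
        by (simp add: L_br)
      also have "\<alpha> (vf_bracket X W # V # Ys) = 0"
        by (rule Cons.prems(4)) (use that V in auto)
      finally show ?thesis by (simp only: minus_zero)
    qed
  qed (use Cons.prems in \<open>auto simp: cochain_insert\<close>)
  then show ?case by simp
qed simp

text \<open>
  This is what allows \<open>contract_ext\<close> to be evaluated on wedge products and to be treated as linear.
  Homogeneity over the reals is linearity over the constant functions.
\<close>
lemma multilinear_alternating_contract:
  assumes "\<omega> \<in> forms d A k" "multisymplectic_action d A \<omega> br v"
  shows "multilinear_alternating (\<lambda>xs. contract (map v xs) \<omega> Ys m)"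
proof (cases "set Ys \<subseteq> \<X>")
  case False
  then have "\<omega> (map v xs @ Ys) = 0" for xs
    using assms(1) by (intro forms_outside) auto
  then show ?thesis
    by (simp add: multilinear_alternating_def contract_apply linear_zero)
next
  case True
  have v: "v x \<in> \<X>" "v (x + y) = v x + v y" "v (c *\<^sub>R x) = (\<lambda>f m. c * v x f m)" for x y c
    using assms(2) by (auto simp: multisymplectic_action_def)
  have sub: "set (map v xs) \<subseteq> \<X>" for xs using v(1) by auto
  have scale: "v (c *\<^sub>R x) = (\<lambda>f. (\<lambda>m. c) * v x f)" for c x
    unfolding v(3) by (simp add: times_fun_def)
  have add: "\<omega> (map v xs @ v (x + y) # map v ys @ Ys)
      = \<omega> (map v xs @ v x # map v ys @ Ys) + \<omega> (map v xs @ v y # map v ys @ Ys)" for xs x y ys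
    unfolding v(2) using True sub v(1) by (intro cochain_add[OF forms_cochain[OF assms(1)]]) auto
  have scaleR: "\<omega> (map v xs @ v (c *\<^sub>R x) # map v ys @ Ys)
      = (\<lambda>m. c) * \<omega> (map v xs @ v x # map v ys @ Ys)" for xs c x ys
    unfolding scale using True sub v(1) smooth_functions_const[of c d A]
    by (intro forms_mult[OF assms(1)]) auto
  have "linear (\<lambda>x. contract (map v (xs @ x # ys)) \<omega> Ys m)" for xs ys
  proof (rule linearI)
    fix x y c
    show "contract (map v (xs @ (x + y) # ys)) \<omega> Ys m
        = contract (map v (xs @ x # ys)) \<omega> Ys m + contract (map v (xs @ y # ys)) \<omega> Ys m"
      using fun_cong[OF add[of xs x y ys], of m] by (simp add: contract_apply)
    show "contract (map v (xs @ (c *\<^sub>R x) # ys)) \<omega> Ys m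
        = c *\<^sub>R contract (map v (xs @ x # ys)) \<omega> Ys m"
      using fun_cong[OF scaleR[of xs c x ys], of m] by (simp add: contract_apply)
  qed
  moreover have "contract (map v xs) \<omega> Ys m = 0" if "\<not> distinct xs" for xs
  proof -
    have "\<not> distinct (map v xs @ Ys)" using that by (auto simp: distinct_map)
    then show ?thesis
      using cochain_not_distinct[OF forms_cochain[OF assms(1)], of "map v xs @ Ys"] True sub
      by (simp add: contract_apply)
  qed
  ultimately show ?thesis by (simp add: multilinear_alternating_def)
qed

lemma contract_ext_wedge:
  assumes "\<omega> \<in> forms d A k" "multisymplectic_action d A \<omega> br v"
  shows "contract_ext v (wedge xs) \<omega> Ys = \<omega> (map v xs @ Ys)"
  using ext_lift_wedge[OF multilinear_alternating_contract[OF assms]]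
  by (intro ext) (simp add: contract_ext_def contract_apply)

lemma contract_ext_add:
  assumes "\<omega> \<in> forms d A k" "multisymplectic_action d A \<omega> br v"
  shows "contract_ext v (p + q) \<omega> Ys = contract_ext v p \<omega> Ys + contract_ext v q \<omega> Ys"
  using linear_add[OF linear_ext_lift[OF multilinear_alternating_contract[OF assms]]]
  by (intro ext) (simp add: contract_ext_def)

lemma contract_ext_scaleR:
  assumes "\<omega> \<in> forms d A k" "multisymplectic_action d A \<omega> br v"
  shows "contract_ext v (c *\<^sub>R p) \<omega> Ys = (\<lambda>m. c * contract_ext v p \<omega> Ys m)"
  using linear_scale[OF linear_ext_lift[OF multilinear_alternating_contract[OF assms]]]
  by (intro ext) (simp add: contract_ext_def)

lemma lie_d_scale:
  assumes "\<And>Zs. set Zs \<subseteq> \<X> \<Longrightarrow> \<alpha> Zs \<in> \<C>" "X \<in> \<X>" "set Ys \<subseteq> \<X>"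
  shows "lie_d X (\<lambda>Zs m. c * \<alpha> Zs m) Ys = (\<lambda>m. c * lie_d X \<alpha> Ys m)"
  using vf_scale[OF assms(2), of "\<alpha> Ys" c] assms(1)[OF assms(3)]
  by (intro ext) (simp add: lie_d_def sum_fun_apply sum_distrib_left right_diff_distrib)

text \<open>
  Both assertions hold for wedge products and define a subspace of the exterior algebra.  That the
  values are smooth is carried along because the Lie derivative is additive on such maps only.
\<close>
lemma lie_d_contract_ext:
  assumes \<omega>: "\<omega> \<in> forms d A k" "closed_form d A \<omega>" and H: "cochain H" "hamiltonian_vf d A \<omega> H X"
    and v: "multisymplectic_action d A \<omega> br v" "locally_preserving d A H v"
    and q: "q \<in> ext_power l" and Ys: "set Ys \<subseteq> \<X>"
  shows "contract_ext v q \<omega> Ys \<in> \<C>" "lie_d X (contract_ext v q \<omega>) Ys = 0"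
proof -
  have X: "X \<in> \<X>" using H(2) by (simp add: hamiltonian_vf_def)
  have vx: "v x \<in> \<X>" "lie_deriv d A (v x) \<omega> = 0" "closed_form d A (lie_deriv d A (v x) H)" for x
    using v by (auto simp: multisymplectic_action_def locally_preserving_def)
  let ?P = "\<lambda>q. (\<forall>Ys. set Ys \<subseteq> \<X> \<longrightarrow> contract_ext v q \<omega> Ys \<in> \<C>) \<and>
    (\<forall>Ys. set Ys \<subseteq> \<X> \<longrightarrow> lie_d X (contract_ext v q \<omega>) Ys = 0)"
  have wedge: "?P (wedge xs)" for xs
  proof (intro conjI allI impI)
    fix Ys assume Ys: "set Ys \<subseteq> \<X>"
    have sub: "set (map v xs) \<subseteq> \<X>" using vx(1) by auto
    with Ys show "contract_ext v (wedge xs) \<omega> Ys \<in> \<C>"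
      by (simp add: contract_ext_wedge[OF \<omega>(1) v(1)] cochain_N[OF forms_cochain[OF \<omega>(1)]])
    have "contract_ext v (wedge xs) \<omega> = (\<lambda>Ys. \<omega> (map v xs @ Ys))"
      by (rule ext) (rule contract_ext_wedge[OF \<omega>(1) v(1)])
    moreover have "lie_d X (\<lambda>Ys. \<omega> (map v xs @ Ys)) Ys = 0"
      by (rule lie_d_contract[OF forms_cochain[OF \<omega>(1)] X _ _ sub Ys])
        (use lie_d_hamiltonian[OF forms_cochain[OF \<omega>(1)] \<omega>(2) H]
          bracket_contraction_zero[OF forms_cochain[OF \<omega>(1)] H vx] in auto)
    ultimately show "lie_d X (contract_ext v (wedge xs) \<omega>) Ys = 0" by simp
  qed
  have "subspace (Collect ?P)"
  proof (rule subspaceI; unfold mem_Collect_eq)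
    have "contract_ext v 0 \<omega> = (\<lambda>Ys. 0)"
      using contract_ext_scaleR[OF \<omega>(1) v(1), of 0 0] by (simp add: fun_eq_iff)
    then show "?P 0" using X by (simp add: smooth_0 lie_d_0)
  next
    fix p q assume *: "?P p" "?P q"
    have "contract_ext v (p + q) \<omega> = (\<lambda>Ys. contract_ext v p \<omega> Ys + contract_ext v q \<omega> Ys)"
      by (rule ext) (rule contract_ext_add[OF \<omega>(1) v(1)])
    then show "?P (p + q)"
      using * X by (simp add: smooth_add lie_d_add)
  next
    fix c p assume *: "?P p"
    have "contract_ext v (c *\<^sub>R p) \<omega> = (\<lambda>Ys m. c * contract_ext v p \<omega> Ys m)"
      by (rule ext) (rule contract_ext_scaleR[OF \<omega>(1) v(1)])
    moreover have "lie_d X (\<lambda>Ys m. c * contract_ext v p \<omega> Ys m) Ys = 0" if "set Ys \<subseteq> \<X>" for Ys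
      using lie_d_scale[of "contract_ext v p \<omega>" X Ys c] * X that by (simp add: fun_eq_iff)
    ultimately show "?P (c *\<^sub>R p)"
      using * by (simp add: smooth_scale)
  qed
  then have "?P q"
    using q span_minimal[of "wedge ` {xs. length xs = l}" "Collect ?P"] wedge
    unfolding ext_power_def by blast
  then show "contract_ext v q \<omega> Ys \<in> \<C>" "lie_d X (contract_ext v q \<omega>) Ys = 0"
    using Ys by blast+
qed

end

theorem proposition2p14:
  fixes d n k :: nat
    and A :: "('m::{t2_space, second_countable_topology}) atlas"
    and \<omega> H :: "'m form"
    and br :: "'g::real_vector \<Rightarrow> 'g \<Rightarrow> 'g"
    and v :: "'g \<Rightarrow> 'm vfield"
    and f :: "nat \<Rightarrow> 'g ext_algebra \<Rightarrow> 'm form"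
    and p :: "'g ext_algebra"
  assumes "pre_plectic d A n \<omega>"
    and "H \<in> hamiltonian_forms d A n \<omega>"
    and "lie_algebra br"
    and "multisymplectic_action d A \<omega> br v"
    and "co_momentum_map d A n \<omega> br v f"
    and "locally_preserving d A H v"
    and "1 \<le> k" and "k \<le> n"
    and "p \<in> lie_boundaries br k"
  shows "p \<in> lie_cycles br k \<and>
         (\<forall>v\<^sub>H. hamiltonian_vf d A \<omega> H v\<^sub>H \<longrightarrow> globally_conserved d A (n - k) v\<^sub>H (f k p))"
proof (intro conjI allI impI)
  interpret lie_algebra_homology br by unfold_locales (rule assms(3))
  show p: "p \<in> lie_cycles br k"
    using assms(9) lie_boundaries_subset_cycles by blast
  interpret M: manifold d A
    using assms(1) by unfold_locales (simp add: pre_plectic_def)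
  have \<omega>: "\<omega> \<in> forms d A (n + 1)" "closed_form d A \<omega>"
    using assms(1) by (auto simp: pre_plectic_def)
  have H: "M.cochain H"
    using assms(2) M.forms_cochain by (auto simp: hamiltonian_forms_def)
  fix X assume ham: "hamiltonian_vf d A \<omega> H X"
  then have X: "X \<in> vector_fields d A" by (simp add: hamiltonian_vf_def)
  obtain q where q: "q \<in> ext_power (Suc k)" "p = lie_boundary br q"
    using assms(9) by (auto simp: lie_boundaries_def)
  have f_form: "f i r \<in> forms d A (n - i)" if "i \<in> {1..n}" "r \<in> ext_power i" for i r
    using assms(5) that unfolding co_momentum_map_def by blast
  \<comment> \<open>zero in top degree \<open>k = n\<close>\<close>
  define \<beta> where "\<beta> = zero_extend n f (Suc k) q"
  have \<beta>: "M.cochain \<beta>"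
  proof (cases "k = n")
    case True
    then show ?thesis by (simp add: \<beta>_def zero_extend_def M.cochain_def M.smooth_0)
  next
    case False
    then show ?thesis
      using assms(8) M.forms_cochain[OF f_form[OF _ q(1)]] by (simp add: \<beta>_def zero_extend_def)
  qed
  \<comment> \<open>The sign goes into the exterior algebra element, so that the lemma on contractions covers it.\<close>
  define c where "c = contract_ext v (varsigma (Suc k) *\<^sub>R q) \<omega>"
  have "varsigma (Suc k) *\<^sub>R q \<in> ext_power (Suc k)"
    using q(1) by (simp add: ext_power_def span_scale)
  note c = M.lie_d_contract_ext[OF \<omega> H ham assms(4,6) this, folded c_def]
  have "\<forall>k\<in>{1..n + 1}. \<forall>p\<in>ext_power k.
      - zero_extend n f (k - 1) (lie_boundary br p) = ext_deriv d A (zero_extend n f k p) +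
          (\<lambda>Xs m. varsigma k * contract_ext v p \<omega> Xs m)"
    using assms(5) unfolding co_momentum_map_def by (elim conjE)
  from this[rule_format, OF _ q(1)]
  have "- zero_extend n f (Suc k - 1) (lie_boundary br q) = ext_deriv d A (zero_extend n f (Suc k) q) +
          (\<lambda>Xs m. varsigma (Suc k) * contract_ext v q \<omega> Xs m)"
    using assms(8) by simp
  moreover have "(\<lambda>Xs m. varsigma (Suc k) * contract_ext v q \<omega> Xs m) = c"
    unfolding c_def by (rule ext, rule M.contract_ext_scaleR[OF \<omega>(1) assms(4), symmetric])
  ultimately have comoment: "- f k p = ext_deriv d A \<beta> + c"
    using assms(7,8) by (simp add: \<beta>_def zero_extend_def q(2))
  have fk: "f k p Ys = (0 - M.ce_d \<beta> Ys) - c Ys" if "set Ys \<subseteq> vector_fields d A" for Ys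
  proof -
    have "f k p Ys = - (- f k p) Ys" by (simp add: fun_Compl_def)
    also have "\<dots> = - (M.ce_d \<beta> Ys + c Ys)"
      unfolding comoment using that by (simp add: M.ext_deriv_eq)
    finally show ?thesis by simp
  qed
  have lie: "lie_deriv d A X (f k p) = ext_deriv d A (- lie_deriv d A X \<beta>)"
  proof
    fix Ys
    show "lie_deriv d A X (f k p) Ys = ext_deriv d A (- lie_deriv d A X \<beta>) Ys"
    proof (cases "set Ys \<subseteq> vector_fields d A")
      case True
      have "M.lie_d X (f k p) Ys = M.lie_d X (\<lambda>Ys. (0 - M.ce_d \<beta> Ys) - c Ys) Ys"
        using True X fk by (intro M.lie_d_cong)
      also have "\<dots> = M.lie_d X (\<lambda>Ys. 0 - M.ce_d \<beta> Ys) Ys - M.lie_d X c Ys"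
        using \<beta> c(1) X True by (intro M.lie_d_diff) (auto intro!: M.smooth_uminus M.N_ce_d)
      also have "M.lie_d X c Ys = 0" using c(2) True .
      also have "M.lie_d X (\<lambda>Ys. 0 - M.ce_d \<beta> Ys) Ys = M.lie_d X (\<lambda>Ys. 0) Ys - M.lie_d X (M.ce_d \<beta>) Ys"
        using \<beta> X True by (intro M.lie_d_diff) (auto intro!: M.smooth_0 M.N_ce_d)
      also have "M.lie_d X (M.ce_d \<beta>) Ys = M.ce_d (M.lie_d X \<beta>) Ys"
        using \<beta> X True by (rule M.lie_d_ce_d_commute)
      also have "M.lie_d X (\<lambda>Ys. 0) Ys = M.ce_d (\<lambda>Ys. 0) Ys"
        using X True by (simp add: M.lie_d_0 M.ce_d_0)
      also have "M.ce_d (\<lambda>Ys. 0) Ys - M.ce_d (M.lie_d X \<beta>) Ys - 0 = M.ce_d (\<lambda>Ys. 0 - M.lie_d X \<beta> Ys) Ys"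
        using \<beta> X True by (subst M.ce_d_diff) (auto intro!: M.smooth_0 M.N_lie_d)
      also have "\<dots> = M.ce_d (- lie_deriv d A X \<beta>) Ys"
        using True by (intro M.ce_d_cong) (simp_all add: M.lie_deriv_eq)
      finally show ?thesis
        using True by (simp add: M.lie_deriv_eq M.ext_deriv_eq)
    qed (simp add: M.lie_deriv_eq M.ext_deriv_eq)
  qed
  show "globally_conserved d A (n - k) X (f k p)"
  proof (cases "k = n")
    \<comment> \<open>An exact 0-form is zero; here the derivative of the primitive vanishes because \<open>\<beta> = 0\<close>.\<close>
    case True
    then have \<beta>0: "\<beta> = (\<lambda>Ys. 0)" by (simp add: \<beta>_def zero_extend_def zero_fun_def)
    have "- lie_deriv d A X \<beta> = (\<lambda>Ys. 0)"
      unfolding \<beta>0 using X by (auto simp: M.lie_deriv_eq M.lie_d_0)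
    then have "ext_deriv d A (- lie_deriv d A X \<beta>) = ext_deriv d A (\<lambda>Ys. 0)" by (rule arg_cong)
    also have "\<dots> = 0"
      by (auto simp: M.ext_deriv_eq M.ce_d_0)
    finally show ?thesis
      using True lie by (simp add: globally_conserved_def exact_form_def)
  next
    case False
    then obtain j where j: "n - k = Suc j" "n - Suc k = j"
      using assms(8) by (metis Suc_diff_Suc le_neq_implies_less)
    have "\<beta> \<in> forms d A j"
      using False assms(8) f_form[OF _ q(1)] j(2) by (simp add: \<beta>_def zero_extend_def)
    then have "- lie_deriv d A X \<beta> \<in> forms d A j"
      by (intro M.forms_uminus M.lie_deriv_forms X)
    with lie show ?thesis by (auto simp: globally_conserved_def exact_form_def j)
  qed
qed

end
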